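(* Let $n\ge1$ and let $\nu,\mu\in\mathbb{R}$ with $\mu>0$. The functions $h^{\nu,\mu}_{r,s}$, $r,s\in\mathbb{Z}_{\ge0}^n$, form a complete orthogonal system in the Hilbert space $L^2(\mathbb{C}^n,d\lambda)$. Moreover, one has the decomposition $$L^2(\mathbb{C}^n,d\lambda)=\bigoplus_{l=0}^{\infty}\mathbf{A}_l,\qquad\text{where}\qquad \mathbf{A}_l=\overline{\operatorname{span}}\{h^{\nu,\mu}_{r,s}:\ r,s\in\mathbb{Z}_{\ge0}^n,\ |r|=l\}.$$
   Context: $d\lambda$ is Lebesgue measure on $\mathbb{C}^n=\mathbb{R}^{2n}$, and $\overline{\operatorname{span}}$ denotes the closed linear span in $L^2(\mathbb{C}^n,d\lambda)$. For a multi-index $m=(m_1,\dots,m_n)\in\mathbb{Z}_{\ge0}^n$: $|m|=m_1+\cdots+m_n$, $z^m=z_1^{m_1}\cdots z_n^{m_n}$, $D^m_z=\frac{\partial^{|m|}}{\partial z_1^{m_1}\cdots\partial z_n^{m_n}}$ and $D^m_{\bar z}=\frac{\partial^{|m|}}{\partial\bar z_1^{m_1}\cdots\partial\bar z_n^{m_n}}$. For $j=1,\dots,n$ let $$a^+_j=-\frac{\partial}{\partial z_j}+\frac{\mu-i\nu}{2}\,\bar z_j .$$ For $r,s\in\mathbb{Z}_{\ge0}^n$ the functions $h^{\nu,\mu}_{r,s}$ on $\mathbb{C}^n$ are defined by $$h^{\nu,\mu}_{r,s}=(a^+_1)^{r_1}\cdots(a^+_n)^{r_n}\left(z^s e^{-\frac{\mu+i\nu}{2}|z|^2}\right)=(-1)^{|r|+|s|}\mu^{-|s|}e^{\frac{\mu-i\nu}{2}|z|^2}D^r_zD^s_{\bar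 z}e^{-\mu|z|^2}.$$ *)

theory Defs
  imports "HOL-Analysis.Analysis"
begin

subsection \<open>The space of square-integrable functions\<close>

text \<open>
  Elements are represented by functions; two of them stand for the same element iff they agree
  almost everywhere. All notions below that take norms or inner products respect this
  identification, and \<open>L2_closure\<close> always yields sets saturated under it.
  Since the library integral of a non-integrable function is \<open>0\<close>, \<open>L2_norm\<close>, \<open>L2_inner\<close> and
  \<open>L2_closure\<close> are meaningful only for (sets of) members of \<open>L2_space\<close>.
\<close>

definition L2_space :: "('a::euclidean_space \<Rightarrow> complex) set" where
  "L2_space = {f \<in> borel_measurable lebesgue. integrable lebesgue (\<lambda>x. (cmod (f x))\<^sup>2)}"

definition L2_inner :: "('a::euclidean_space \<Rightarrow> complex) \<Rightarrow> ('a \<Rightarrow> complex) \<Rightarrow> complex" where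
  "L2_inner f g = (LINT x|lebesgue. f x * cnj (g x))"

definition L2_norm :: "('a::euclidean_space \<Rightarrow> complex) \<Rightarrow> real" where
  "L2_norm f = sqrt (LINT x|lebesgue. (cmod (f x))\<^sup>2)"

definition L2_closure :: "('a::euclidean_space \<Rightarrow> complex) set \<Rightarrow> ('a \<Rightarrow> complex) set" where
  "L2_closure S = {f \<in> L2_space. \<forall>e>0. \<exists>g\<in>S. L2_norm (\<lambda>x. f x - g x) < e}"

definition complex_span :: "('a \<Rightarrow> complex) set \<Rightarrow> ('a \<Rightarrow> complex) set" where
  "complex_span S = {(\<lambda>x. \<Sum>g\<in>T. c g * g x) | T c. finite T \<and> T \<subseteq> S}"

definition L2_closed_span :: "('a::euclidean_space \<Rightarrow> complex) set \<Rightarrow> ('a \<Rightarrow> complex) set" where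
  "L2_closed_span S = L2_closure (complex_span S)"

definition L2_closed_subspace :: "('a::euclidean_space \<Rightarrow> complex) set \<Rightarrow> bool" where
  "L2_closed_subspace A \<longleftrightarrow>
     A \<subseteq> L2_space \<and> (\<lambda>x. 0) \<in> A \<and>
     (\<forall>f\<in>A. \<forall>g\<in>A. (\<lambda>x. f x + g x) \<in> A) \<and>
     (\<forall>c. \<forall>f\<in>A. (\<lambda>x. c * f x) \<in> A) \<and>
     L2_closure A \<subseteq> A"

text \<open>The members of an orthogonal system are required to be nonzero.\<close>

definition complete_orthogonal_system :: "('i \<Rightarrow> 'a::euclidean_space \<Rightarrow> complex) \<Rightarrow> bool" where
  "complete_orthogonal_system h \<longleftrightarrow>
     (\<forall>i. h i \<in> L2_space \<and> L2_norm (h i) \<noteq> 0) \<and>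
     (\<forall>i j. i \<noteq> j \<longrightarrow> L2_inner (h i) (h j) = 0) \<and>
     L2_closed_span (range h) = L2_space"

text \<open>
  The whole space is the orthogonal Hilbert sum of the \<open>A l\<close>. The components \<open>g l\<close> of \<open>f\<close> are
  then unique up to null sets, because the summands are mutually orthogonal.
\<close>

definition L2_orthogonal_sum :: "(nat \<Rightarrow> ('a::euclidean_space \<Rightarrow> complex) set) \<Rightarrow> bool" where
  "L2_orthogonal_sum A \<longleftrightarrow>
     (\<forall>l. L2_closed_subspace (A l)) \<and>
     (\<forall>k l. k \<noteq> l \<longrightarrow> (\<forall>f\<in>A k. \<forall>g\<in>A l. L2_inner f g = 0)) \<and>
     (\<forall>f\<in>L2_space. \<exists>g. (\<forall>l. g l \<in> A l) \<and>
        (\<lambda>N. L2_norm (\<lambda>x. f x - (\<Sum>l<N. g l x))) \<longlonglongrightarrow> 0)"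


subsection \<open>The functions \<open>h\<close>\<close>

text \<open>
  \<open>\<complex>\<^sup>n\<close> is \<open>complex ^ 'n\<close>, with Lebesgue measure of the underlying \<open>2n\<close>-dimensional real
  Euclidean space. The Wirtinger derivative is
  \<open>\<partial>/\<partial>z\<^sub>j = (\<partial>/\<partial>x\<^sub>j - i \<partial>/\<partial>y\<^sub>j) / 2\<close> where \<open>z\<^sub>j = x\<^sub>j + i y\<^sub>j\<close>.
\<close>

definition partial_z :: "'n::finite \<Rightarrow> (complex ^ 'n \<Rightarrow> complex) \<Rightarrow> complex ^ 'n \<Rightarrow> complex" where
  "partial_z j f z =
     (vector_derivative (\<lambda>t::real. f (z + t *\<^sub>R axis j 1)) (at 0)
      - \<i> * vector_derivative (\<lambda>t::real. f (z + t *\<^sub>R axis j \<i>)) (at 0)) / 2"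

definition a_plus ::
  "real \<Rightarrow> real \<Rightarrow> 'n::finite \<Rightarrow> (complex ^ 'n \<Rightarrow> complex) \<Rightarrow> complex ^ 'n \<Rightarrow> complex" where
  "a_plus \<nu> \<mu> j f z =
     - partial_z j f z + (of_real \<mu> - \<i> * of_real \<nu>) / 2 * cnj (z $ j) * f z"

definition mpow :: "complex ^ 'n::finite \<Rightarrow> nat ^ 'n \<Rightarrow> complex" where
  "mpow z s = (\<Prod>j\<in>UNIV. (z $ j) ^ (s $ j))"

definition msize :: "nat ^ 'n::finite \<Rightarrow> nat" where
  "msize r = (\<Sum>j\<in>UNIV. r $ j)"

text \<open>
  The linear order on the index type only fixes the order in which the operators
  \<open>(a\<^sup>+\<^sub>1)\<^bsup>r\<^sub>1\<^esup> \<cdots> (a\<^sup>+\<^sub>n)\<^bsup>r\<^sub>n\<^esup>\<close> are composed: the one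
  with the largest index is applied first.
\<close>

definition h_fun ::
  "real \<Rightarrow> real \<Rightarrow> nat ^ ('n::{finite,linorder}) \<Rightarrow> nat ^ ('n::{finite,linorder}) \<Rightarrow>
   complex ^ ('n::{finite,linorder}) \<Rightarrow> complex" where
  "h_fun \<nu> \<mu> r s =
     foldr (\<lambda>j. a_plus \<nu> \<mu> j ^^ (r $ j)) (sorted_list_of_set UNIV)
       (\<lambda>z. mpow z s * exp (- ((of_real \<mu> + \<i> * of_real \<nu>) / 2 * of_real ((norm z)\<^sup>2))))"

definition A_space ::
  "real \<Rightarrow> real \<Rightarrow> nat \<Rightarrow> (complex ^ 'n::{finite,linorder} \<Rightarrow> complex) set" where
  "A_space \<nu> \<mu> l = L2_closed_span {h_fun \<nu> \<mu> r s | r s. msize r = l}"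

end

theory Submission
  imports Defs "HOL-Probability.Distributions"
begin

text \<open>
  Put \<open>c = (\<mu> + i \<nu>) / 2\<close>. Conjugating \<open>a\<^sup>+\<^sub>j\<close> with \<open>exp (- c |z|\<^sup>2)\<close> turns it into
  \<open>\<mu> cnj z\<^sub>j - \<partial>/\<partial>z\<^sub>j\<close>, so \<open>\<nu>\<close> survives only in the exponent and \<open>h\<^sub>r\<^sub>,\<^sub>s\<close> is a product of
  one-variable polynomials in \<open>z\<^sub>j\<close> and \<open>cnj z\<^sub>j\<close> (Ito's complex Hermite polynomials) times the
  Gaussian \<open>exp (- c |z|\<^sup>2)\<close> (\<open>h_fun_eq\<close>).

  Orthogonality comes from ladder relations. Derivatives of functions of Gaussian decay have
  integral zero, by translation invariance of Lebesgue measure; hence raising an index in one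
  argument of the inner product is, up to a factor, lowering the same index in the other argument
  (\<open>gauss_inner_raise\<close>). The factor vanishes when there is nothing left to lower, so two
  functions with different indices are orthogonal, and the norms of all members are positive
  multiples of the norm of the Gaussian (\<open>gauss_inner_orthogonal\<close>).

  For completeness, the ladder relations show that the span of the system is stable under
  multiplication by \<open>z\<^sub>j\<close> and \<open>cnj z\<^sub>j\<close>. Its closure \<open>A\<close> therefore contains every
  \<open>exp (i \<xi>\<bullet>z) exp (- c |z|\<^sup>2)\<close>, by the exponential series (\<open>character_gauss_mem\<close>). Any closed
  subspace that contains the products of all characters with a fixed zero-free weight is the
  whole of \<open>L\<^sup>2\<close> (\<open>L2_space_subset_if_weighted_characters\<close>): trigonometric polynomials with a
  common bound approximate a bounded continuous function locally uniformly, continuous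
  functions approximate bounded measurable ones almost everywhere, truncation does the rest, and
  dominated convergence turns each of these into convergence in \<open>L\<^sup>2\<close>.

  The decomposition is then general Hilbert space theory: the \<open>A\<^sub>l\<close> are closed and mutually
  orthogonal, and finite sums of their members are dense, so the orthogonal projections of \<open>f\<close>
  sum up to \<open>f\<close> (\<open>L2_orthogonal_sumI\<close>). Projections exist because \<open>L\<^sup>2\<close> is complete.
\<close>

section \<open>Inner product and norm of square-integrable functions\<close>

lemma borel_measurable_cnj: "cnj \<in> borel_measurable borel"
  by (rule borel_measurable_continuous_onI) (rule continuous_on_cnj[OF continuous_on_id])

lemma L2_measurable: "f \<in> L2_space \<Longrightarrow> f \<in> borel_measurable lebesgue"
  by (simp add: L2_space_def)

lemma L2_integrable: "f \<in> L2_space \<Longrightarrow> integrable lebesgue (\<lambda>x. (cmod (f x))\<^sup>2)"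
  by (simp add: L2_space_def)

lemma L2_dominatedI:
  assumes "f \<in> borel_measurable lebesgue" "integrable lebesgue W"
    and "AE x in lebesgue. (cmod (f x))\<^sup>2 \<le> W x"
  shows "f \<in> L2_space"
proof -
  have "integrable lebesgue (\<lambda>x. (cmod (f x))\<^sup>2)"
  proof (rule Bochner_Integration.integrable_bound[OF assms(2)])
    show "(\<lambda>x. (cmod (f x))\<^sup>2) \<in> borel_measurable lebesgue"
      using assms(1) by measurable
    show "AE x in lebesgue. norm ((cmod (f x))\<^sup>2) \<le> norm (W x)"
      using assms(3) by eventually_elim simp
  qed
  with assms(1) show ?thesis by (simp add: L2_space_def)
qed

lemma L2_product_integrable:
  assumes "f \<in> L2_space" "g \<in> L2_space"
  shows "integrable lebesgue (\<lambda>x. f x * cnj (g x))"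
    and "integrable lebesgue (\<lambda>x. cmod (f x) * cmod (g x))"
proof -
  have m[measurable]: "f \<in> borel_measurable lebesgue" "g \<in> borel_measurable lebesgue"
    using assms by (auto simp: L2_measurable)
  have W: "integrable lebesgue (\<lambda>x. (cmod (f x))\<^sup>2 + (cmod (g x))\<^sup>2)"
    using assms by (auto simp: L2_space_def)
  have le: "cmod (f x) * cmod (g x) \<le> (cmod (f x))\<^sup>2 + (cmod (g x))\<^sup>2" for x
    using sum_squares_bound[of "cmod (f x)" "cmod (g x)"]
      mult_nonneg_nonneg[OF norm_ge_zero[of "f x"] norm_ge_zero[of "g x"]] by linarith
  have m2: "(\<lambda>x. f x * cnj (g x)) \<in> borel_measurable lebesgue"
    by (intro borel_measurable_times m(1) measurable_compose[OF m(2) borel_measurable_cnj])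
  show "integrable lebesgue (\<lambda>x. f x * cnj (g x))"
    by (rule Bochner_Integration.integrable_bound[OF W m2]) (simp add: norm_mult le)
  show "integrable lebesgue (\<lambda>x. cmod (f x) * cmod (g x))"
    by (rule Bochner_Integration.integrable_bound[OF W]) (simp_all add: norm_mult le)
qed

lemma L2_zero: "(\<lambda>x. 0) \<in> L2_space"
  by (simp add: L2_space_def)

lemma L2_scale: "f \<in> L2_space \<Longrightarrow> (\<lambda>x. c * f x) \<in> L2_space"
  by (auto simp: L2_space_def norm_mult power_mult_distrib)

lemma L2_add:
  assumes "f \<in> L2_space" "g \<in> L2_space"
  shows "(\<lambda>x. f x + g x) \<in> L2_space"
proof (rule L2_dominatedI)
  show "(\<lambda>x. f x + g x) \<in> borel_measurable lebesgue"
    using assms by (intro borel_measurable_add L2_measurable)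
  show "integrable lebesgue (\<lambda>x. (cmod (f x))\<^sup>2 + 2 * (cmod (f x) * cmod (g x)) + (cmod (g x))\<^sup>2)"
    using assms by (auto simp: L2_integrable L2_product_integrable)
  have "(cmod (f x + g x))\<^sup>2 \<le> (cmod (f x))\<^sup>2 + 2 * (cmod (f x) * cmod (g x)) + (cmod (g x))\<^sup>2" for x
    using power_mono[OF norm_triangle_ineq[of "f x" "g x"], of 2] by (simp add: power2_sum algebra_simps)
  thus "AE x in lebesgue. (cmod (f x + g x))\<^sup>2
          \<le> (cmod (f x))\<^sup>2 + 2 * (cmod (f x) * cmod (g x)) + (cmod (g x))\<^sup>2" by simp
qed

lemma L2_diff:
  assumes "f \<in> L2_space" "g \<in> L2_space"
  shows "(\<lambda>x. f x - g x) \<in> L2_space"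
  using L2_add[OF assms(1) L2_scale[OF assms(2), of "-1"]] by simp

lemma L2_sum: "(\<And>i. i \<in> I \<Longrightarrow> f i \<in> L2_space) \<Longrightarrow> (\<lambda>x. \<Sum>i\<in>I. f i x) \<in> L2_space"
  by (induction I rule: infinite_finite_induct) (auto simp: L2_zero L2_add)

lemma L2_inner_add_left:
  "\<lbrakk>f \<in> L2_space; g \<in> L2_space; k \<in> L2_space\<rbrakk> \<Longrightarrow>
   L2_inner (\<lambda>x. f x + g x) k = L2_inner f k + L2_inner g k"
  unfolding L2_inner_def by (simp add: ring_distribs L2_product_integrable)

lemma L2_inner_scale_left: "L2_inner (\<lambda>x. c * f x) k = c * L2_inner f k"
  unfolding L2_inner_def by (simp add: mult.assoc)

lemma L2_inner_cnj: "L2_inner f g = cnj (L2_inner g f)"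
  unfolding L2_inner_def
  using Bochner_Integration.integral_cnj[of lebesgue "\<lambda>x. g x * cnj (f x)"] by (simp add: mult.commute del: Bochner_Integration.integral_cnj)

lemma L2_inner_diff_left:
  "\<lbrakk>f \<in> L2_space; g \<in> L2_space; k \<in> L2_space\<rbrakk> \<Longrightarrow>
   L2_inner (\<lambda>x. f x - g x) k = L2_inner f k - L2_inner g k"
  unfolding L2_inner_def by (simp add: ring_distribs L2_product_integrable)

lemma L2_inner_sum_left:
  "\<lbrakk>\<And>i. i \<in> I \<Longrightarrow> f i \<in> L2_space; k \<in> L2_space\<rbrakk> \<Longrightarrow>
   L2_inner (\<lambda>x. \<Sum>i\<in>I. f i x) k = (\<Sum>i\<in>I. L2_inner (f i) k)"
  unfolding L2_inner_def
  by (simp add: sum_distrib_right L2_product_integrable Bochner_Integration.integral_sum)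

lemma L2_norm_nonneg: "L2_norm f \<ge> 0"
  by (simp add: L2_norm_def)

lemma L2_norm_power2: "(L2_norm f)\<^sup>2 = (LINT x|lebesgue. (cmod (f x))\<^sup>2)"
  by (simp add: L2_norm_def)

lemma L2_inner_self: "L2_inner f f = of_real ((L2_norm f)\<^sup>2)"
  unfolding L2_inner_def L2_norm_power2 complex_norm_square[symmetric]
  by (rule integral_complex_of_real)

lemma L2_norm_scale: "L2_norm (\<lambda>x. c * f x) = cmod c * L2_norm f"
  by (simp add: L2_norm_def norm_mult power_mult_distrib real_sqrt_mult)

lemma L2_norm_minus_commute: "L2_norm (\<lambda>x. f x - g x) = L2_norm (\<lambda>x. g x - f x)"
  by (simp add: L2_norm_def norm_minus_commute)

text \<open>The integral of \<open>(|f| - t |g|)\<^sup>2\<close> is a quadratic in \<open>t\<close> without negative values.\<close>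

lemma L2_Cauchy_Schwarz_norms:
  assumes "f \<in> L2_space" "g \<in> L2_space"
  shows "(LINT x|lebesgue. cmod (f x) * cmod (g x)) \<le> L2_norm f * L2_norm g"
proof -
  define a where "a = (LINT x|lebesgue. cmod (f x) * cmod (g x))"
  define F where "F = (L2_norm f)\<^sup>2"
  define G where "G = (L2_norm g)\<^sup>2"
  have q: "0 \<le> F - 2 * t * a + t\<^sup>2 * G" for t
  proof -
    have "0 \<le> (LINT x|lebesgue. (cmod (f x) - t * cmod (g x))\<^sup>2)" by simp
    also have "\<dots> = (LINT x|lebesgue. (cmod (f x))\<^sup>2 - 2 * t * (cmod (f x) * cmod (g x)) + t\<^sup>2 * (cmod (g x))\<^sup>2)"
      by (simp add: power2_diff power_mult_distrib algebra_simps)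
    also have "\<dots> = F - 2 * t * a + t\<^sup>2 * G"
      using assms by (simp add: F_def G_def a_def L2_norm_power2 L2_integrable L2_product_integrable)
    finally show ?thesis .
  qed
  have "a\<^sup>2 \<le> F * G"
  proof (cases "G = 0")
    case True
    have "a = 0"
    proof (rule ccontr)
      assume "a \<noteq> 0"
      \<comment> \<open>Here the quadratic is affine, and this \<open>t\<close> gives it the value \<open>-1\<close>.\<close>
      with q[of "(F + 1) / (2 * a)"] True show False by simp
    qed
    with True show ?thesis by simp
  next
    case False
    hence "G > 0" by (simp add: G_def less_le)
    \<comment> \<open>The quadratic is evaluated at its minimum.\<close>
    with q[of "a / G"] show ?thesis by (simp add: field_simps power2_eq_square)
  qed
  hence "a\<^sup>2 \<le> (L2_norm f * L2_norm g)\<^sup>2" by (simp add: F_def G_def power_mult_distrib)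
  thus ?thesis unfolding a_def[symmetric]
    by (rule power2_le_imp_le) (simp add: L2_norm_nonneg)
qed

lemma L2_Cauchy_Schwarz:
  assumes "f \<in> L2_space" "g \<in> L2_space"
  shows "cmod (L2_inner f g) \<le> L2_norm f * L2_norm g"
proof -
  have "cmod (L2_inner f g) \<le> (LINT x|lebesgue. cmod (f x * cnj (g x)))"
    unfolding L2_inner_def by (rule integral_norm_bound)
  also have "\<dots> = (LINT x|lebesgue. cmod (f x) * cmod (g x))" by (simp add: norm_mult)
  finally show ?thesis using L2_Cauchy_Schwarz_norms[OF assms] by linarith
qed

lemma L2_norm_diff_power2:
  assumes "f \<in> L2_space" "g \<in> L2_space"
  shows "(L2_norm (\<lambda>x. f x - g x))\<^sup>2 = (L2_norm f)\<^sup>2 - 2 * Re (L2_inner f g) + (L2_norm g)\<^sup>2"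
proof -
  have "(LINT x|lebesgue. (cmod (f x - g x))\<^sup>2)
      = (LINT x|lebesgue. (cmod (f x))\<^sup>2 - 2 * Re (f x * cnj (g x)) + (cmod (g x))\<^sup>2)"
    by (rule Bochner_Integration.integral_cong) (auto simp: cmod_power2 power2_diff algebra_simps)
  also have "\<dots> = (LINT x|lebesgue. (cmod (f x))\<^sup>2) - 2 * Re (L2_inner f g) + (LINT x|lebesgue. (cmod (g x))\<^sup>2)"
    using L2_product_integrable(1)[OF assms]
    by (simp add: L2_integrable assms L2_inner_def integral_Re integrable_Re del: times_complex.sel)
  finally show ?thesis by (simp add: L2_norm_power2)
qed

lemma L2_norm_triangle:
  assumes "f \<in> L2_space" "g \<in> L2_space"
  shows "L2_norm (\<lambda>x. f x + g x) \<le> L2_norm f + L2_norm g"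
proof (rule power2_le_imp_le)
  have m: "(\<lambda>x. - g x) \<in> L2_space" using L2_scale[OF assms(2), of "-1"] by simp
  have n: "L2_norm (\<lambda>x. - g x) = L2_norm g" by (simp add: L2_norm_def)
  have "(L2_norm (\<lambda>x. f x + g x))\<^sup>2 = (L2_norm f)\<^sup>2 - 2 * Re (L2_inner f (\<lambda>x. - g x)) + (L2_norm g)\<^sup>2"
    using L2_norm_diff_power2[OF assms(1) m] n by simp
  moreover have "- Re (L2_inner f (\<lambda>x. - g x)) \<le> L2_norm f * L2_norm g"
    using L2_Cauchy_Schwarz[OF assms(1) m] abs_Re_le_cmod[of "L2_inner f (\<lambda>x. - g x)"] unfolding n
    by linarith
  ultimately show "(L2_norm (\<lambda>x. f x + g x))\<^sup>2 \<le> (L2_norm f + L2_norm g)\<^sup>2"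
    by (simp add: power2_sum)
qed (simp add: L2_norm_nonneg)

lemma L2_dist_triangle:
  assumes "f \<in> L2_space" "g \<in> L2_space" "k \<in> L2_space"
  shows "L2_norm (\<lambda>x. f x - k x) \<le> L2_norm (\<lambda>x. f x - g x) + L2_norm (\<lambda>x. g x - k x)"
  using L2_norm_triangle[OF L2_diff[OF assms(1,2)] L2_diff[OF assms(2,3)]] by simp

section \<open>Closed spans and orthogonality\<close>

lemma complex_span_base: "g \<in> S \<Longrightarrow> g \<in> complex_span S"
  unfolding complex_span_def
  by (rule CollectI, rule exI[of _ "{g}"], rule exI[of _ "\<lambda>_. 1"]) auto

lemma complex_span_zero: "(\<lambda>x. 0) \<in> complex_span S"
  unfolding complex_span_def by (rule CollectI, rule exI[of _ "{}"]) auto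

lemma complex_span_scale: "f \<in> complex_span S \<Longrightarrow> (\<lambda>x. a * f x) \<in> complex_span S"
proof -
  assume "f \<in> complex_span S"
  then obtain T c where T: "finite T" "T \<subseteq> S" and f: "f = (\<lambda>x. \<Sum>g\<in>T. c g * g x)"
    by (auto simp: complex_span_def)
  have "(\<lambda>x. a * f x) = (\<lambda>x. \<Sum>g\<in>T. (a * c g) * g x)"
    by (simp add: f sum_distrib_left mult.assoc)
  with T show ?thesis unfolding complex_span_def by auto
qed

lemma complex_span_add:
  assumes "f \<in> complex_span S" "f' \<in> complex_span S"
  shows "(\<lambda>x. f x + f' x) \<in> complex_span S"
proof -
  from assms obtain T c T' c' where T: "finite T" "T \<subseteq> S" "finite T'" "T' \<subseteq> S"
    and f: "f = (\<lambda>x. \<Sum>g\<in>T. c g * g x)" and f': "f' = (\<lambda>x. \<Sum>g\<in>T'. c' g * g x)"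
    by (auto simp: complex_span_def)
  let ?d = "\<lambda>g. (if g \<in> T then c g else 0) + (if g \<in> T' then c' g else 0)"
  have a: "(\<Sum>g\<in>T \<union> T'. (if g \<in> T then c g else 0) * g x) = f x" for x
    unfolding f using T by (intro sum.mono_neutral_cong_right) auto
  have b: "(\<Sum>g\<in>T \<union> T'. (if g \<in> T' then c' g else 0) * g x) = f' x" for x
    unfolding f' using T by (intro sum.mono_neutral_cong_right) auto
  have "(\<lambda>x. f x + f' x) = (\<lambda>x. \<Sum>g\<in>T \<union> T'. ?d g * g x)"
    by (simp only: a[symmetric] b[symmetric] sum.distrib[symmetric] ring_distribs)
  with T show ?thesis unfolding complex_span_def
    by (intro CollectI exI[of _ "T \<union> T'"] exI[of _ ?d]) auto
qed

lemma complex_span_induct [consumes 1, case_names zero add scale base]: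
  assumes "f \<in> complex_span S"
    and "P (\<lambda>x. 0)"
    and "\<And>f g. P f \<Longrightarrow> P g \<Longrightarrow> P (\<lambda>x. f x + g x)"
    and "\<And>c f. P f \<Longrightarrow> P (\<lambda>x. c * f x)"
    and "\<And>f. f \<in> S \<Longrightarrow> P f"
  shows "P f"
proof -
  from assms(1) obtain T c where T: "finite T" "T \<subseteq> S" and f: "f = (\<lambda>x. \<Sum>g\<in>T. c g * g x)"
    by (auto simp: complex_span_def)
  have "P (\<lambda>x. \<Sum>g\<in>T. c g * g x)" using T
    by (induction T) (use assms in auto)
  thus ?thesis by (simp add: f)
qed

lemma complex_span_subset_L2: "S \<subseteq> L2_space \<Longrightarrow> complex_span S \<subseteq> L2_space"
proof
  fix f assume S: "S \<subseteq> L2_space" and "f \<in> complex_span S"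
  from this(2) show "f \<in> L2_space"
  proof (induction rule: complex_span_induct)
    case zero show ?case by (rule L2_zero)
  next
    case (add f g) thus ?case by (rule L2_add)
  next
    case (scale c f) thus ?case by (rule L2_scale)
  next
    case (base f) with S show ?case by blast
  qed
qed

lemma L2_closure_subset: "S \<subseteq> L2_space \<Longrightarrow> S \<subseteq> L2_closure S"
proof
  fix f assume "S \<subseteq> L2_space" "f \<in> S"
  moreover have "L2_norm (\<lambda>x. f x - f x) = 0" by (simp add: L2_norm_def)
  ultimately show "f \<in> L2_closure S" 
    unfolding L2_closure_def by (auto intro!: bexI[of _ f])
qed

lemma L2_closure_closure:
  assumes "S \<subseteq> L2_space"
  shows "L2_closure (L2_closure S) \<subseteq> L2_closure S"
proof
  fix f assume f: "f \<in> L2_closure (L2_closure S)"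
  hence f2: "f \<in> L2_space" by (simp add: L2_closure_def)
  have "\<exists>g\<in>S. L2_norm (\<lambda>x. f x - g x) < e" if "e > 0" for e
  proof -
    have e2: "e / 2 > 0" using \<open>e > 0\<close> by simp
    from f e2 obtain k where k: "k \<in> L2_closure S" "L2_norm (\<lambda>x. f x - k x) < e / 2"
      unfolding L2_closure_def by blast
    from k(1) e2 obtain g where g: "g \<in> S" "L2_norm (\<lambda>x. k x - g x) < e / 2"
      unfolding L2_closure_def by blast
    have "k \<in> L2_space" "g \<in> L2_space" using k g assms by (auto simp: L2_closure_def)
    from L2_dist_triangle[OF f2 this] k(2) g(2) have "L2_norm (\<lambda>x. f x - g x) < e" by linarith
    with g(1) show ?thesis by blast
  qed
  with f2 show "f \<in> L2_closure S" by (simp add: L2_closure_def)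
qed

lemma L2_closed_subspace_closed_span:
  assumes "S \<subseteq> L2_space"
  shows "L2_closed_subspace (L2_closed_span S)"
proof -
  let ?V = "complex_span S"
  have V: "?V \<subseteq> L2_space" by (rule complex_span_subset_L2[OF assms])
  note VC = L2_closure_subset[OF V]
  have add: "(\<lambda>x. f x + g x) \<in> L2_closure ?V" if "f \<in> L2_closure ?V" "g \<in> L2_closure ?V" for f g
  proof -
    from that have fg: "f \<in> L2_space" "g \<in> L2_space" by (auto simp: L2_closure_def)
    have "\<exists>k\<in>?V. L2_norm (\<lambda>x. (f x + g x) - k x) < e" if "e > 0" for e
    proof -
      have e2: "e / 2 > 0" using \<open>e > 0\<close> by simp
      from \<open>f \<in> L2_closure _\<close> e2 obtain u where u: "u \<in> ?V" "L2_norm (\<lambda>x. f x - u x) < e / 2"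
        unfolding L2_closure_def by blast
      from \<open>g \<in> L2_closure _\<close> e2 obtain v where v: "v \<in> ?V" "L2_norm (\<lambda>x. g x - v x) < e / 2"
        unfolding L2_closure_def by blast
      have "u \<in> L2_space" "v \<in> L2_space" using u v V by auto
      from L2_norm_triangle[OF L2_diff[OF fg(1) this(1)] L2_diff[OF fg(2) this(2)]] u v
      have "L2_norm (\<lambda>x. (f x + g x) - (u x + v x)) < e"
        by (simp add: add_diff_add)
      thus ?thesis using complex_span_add[OF u(1) v(1)]
        by (intro bexI[of _ "\<lambda>x. u x + v x"])
    qed
    with L2_add[OF fg] show ?thesis by (simp add: L2_closure_def)
  qed
  have scale: "(\<lambda>x. c * f x) \<in> L2_closure ?V" if "f \<in> L2_closure ?V" for c f
  proof -
    from that have f: "f \<in> L2_space" by (auto simp: L2_closure_def)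
    have "\<exists>k\<in>?V. L2_norm (\<lambda>x. c * f x - k x) < e" if "e > 0" for e
    proof -
      have e2: "e / (cmod c + 1) > 0" using \<open>e > 0\<close> by (simp add: add_nonneg_pos)
      with \<open>f \<in> L2_closure _\<close> obtain u where u: "u \<in> ?V" "L2_norm (\<lambda>x. f x - u x) < e / (cmod c + 1)"
        unfolding L2_closure_def by blast
      have "L2_norm (\<lambda>x. c * f x - c * u x) = cmod c * L2_norm (\<lambda>x. f x - u x)"
        using L2_norm_scale[of c "\<lambda>x. f x - u x"] by (simp add: right_diff_distrib)
      also have "\<dots> \<le> (cmod c + 1) * L2_norm (\<lambda>x. f x - u x)"
        by (intro mult_right_mono) (auto simp: L2_norm_nonneg)
      also have "\<dots> < e" using u(2) by (simp add: pos_less_divide_eq add_nonneg_pos mult.commute)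
      finally show ?thesis using complex_span_scale[OF u(1)]
        by (intro bexI[of _ "\<lambda>x. c * u x"])
    qed
    with L2_scale[OF f] show ?thesis by (simp add: L2_closure_def)
  qed
  have "L2_closure ?V \<subseteq> L2_space" by (auto simp: L2_closure_def)
  moreover have "(\<lambda>x. 0) \<in> L2_closure ?V" using VC complex_span_zero by blast
  ultimately show ?thesis
    unfolding L2_closed_subspace_def L2_closed_span_def
    using add scale L2_closure_closure[OF V] by blast
qed

lemma L2_closed_span_base: "S \<subseteq> L2_space \<Longrightarrow> g \<in> S \<Longrightarrow> g \<in> L2_closed_span S"
  unfolding L2_closed_span_def
  using L2_closure_subset[OF complex_span_subset_L2] complex_span_base by blast

lemma L2_closed_subspaceD:
  assumes "L2_closed_subspace A"
  shows "f \<in> A \<Longrightarrow> f \<in> L2_space" "(\<lambda>x. 0) \<in> A"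
    "f \<in> A \<Longrightarrow> g \<in> A \<Longrightarrow> (\<lambda>x. f x + g x) \<in> A"
    "f \<in> A \<Longrightarrow> (\<lambda>x. c * f x) \<in> A"
  using assms unfolding L2_closed_subspace_def by auto

lemma L2_closed_subspace_sum:
  assumes "L2_closed_subspace A" "\<And>i. i \<in> I \<Longrightarrow> f i \<in> A"
  shows "(\<lambda>x. \<Sum>i\<in>I. f i x) \<in> A"
  using assms(2)
  by (induction I rule: infinite_finite_induct) (auto intro: L2_closed_subspaceD[OF assms(1)])

lemma L2_closed_subspace_limit:
  assumes A: "L2_closed_subspace A" and "\<And>n. F n \<in> A" "f \<in> L2_space"
    and lim: "(\<lambda>n. L2_norm (\<lambda>x. f x - F n x)) \<longlonglongrightarrow> 0"
  shows "f \<in> A"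
proof -
  have "\<exists>g\<in>A. L2_norm (\<lambda>x. f x - g x) < e" if "e > 0" for e
    using order_tendstoD(2)[OF lim that] assms(2) by (auto simp: eventually_sequentially)
  hence "f \<in> L2_closure A" using assms(3) by (simp add: L2_closure_def)
  thus ?thesis using A by (auto simp: L2_closed_subspace_def)
qed

lemma complex_span_subset_closed_subspace:
  assumes "L2_closed_subspace A" "S \<subseteq> A"
  shows "complex_span S \<subseteq> A"
proof
  fix f assume "f \<in> complex_span S"
  thus "f \<in> A"
  proof (induction rule: complex_span_induct)
    case zero show ?case by (rule L2_closed_subspaceD(2)[OF assms(1)])
  next
    case (add f g) thus ?case by (rule L2_closed_subspaceD(3)[OF assms(1)])
  next
    case (scale c f) thus ?case by (rule L2_closed_subspaceD(4)[OF assms(1)])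
  next
    case (base f) with assms(2) show ?case by blast
  qed
qed

lemma L2_closed_span_subset_closed_subspace:
  assumes "L2_closed_subspace A" "S \<subseteq> A"
  shows "L2_closed_span S \<subseteq> A"
proof -
  have "L2_closure (complex_span S) \<subseteq> L2_closure A"
    using complex_span_subset_closed_subspace[OF assms] unfolding L2_closure_def by blast
  with assms(1) show ?thesis unfolding L2_closed_span_def L2_closed_subspace_def by blast
qed

text \<open>By Cauchy--Schwarz, \<open>L2_inner f g\<close> depends continuously on \<open>f\<close>.\<close>

lemma L2_closed_subspace_orthogonal_complement:
  assumes g: "g \<in> L2_space"
  shows "L2_closed_subspace {f \<in> L2_space. L2_inner f g = 0}" (is "L2_closed_subspace ?A")
proof -
  have "f \<in> ?A" if f: "f \<in> L2_closure ?A" for f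
  proof -
    from f have f2: "f \<in> L2_space" by (simp add: L2_closure_def)
    have "cmod (L2_inner f g) \<le> e" if "e > 0" for e
    proof -
      have e2: "e / (L2_norm g + 1) > 0" using \<open>e > 0\<close> by (simp add: add_nonneg_pos L2_norm_nonneg)
      with f obtain u where u: "u \<in> ?A" "L2_norm (\<lambda>x. f x - u x) < e / (L2_norm g + 1)"
        unfolding L2_closure_def by blast
      have "L2_inner f g = L2_inner (\<lambda>x. f x - u x) g"
        using u f2 g by (simp add: L2_inner_diff_left)
      also have "cmod \<dots> \<le> L2_norm (\<lambda>x. f x - u x) * L2_norm g"
        using u f2 g by (intro L2_Cauchy_Schwarz L2_diff) auto
      also have "\<dots> \<le> L2_norm (\<lambda>x. f x - u x) * (L2_norm g + 1)"
        by (intro mult_left_mono) (auto simp: L2_norm_nonneg)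
      also have "\<dots> \<le> e" using u(2) by (simp add: pos_less_divide_eq add_nonneg_pos L2_norm_nonneg)
      finally show ?thesis .
    qed
    hence "cmod (L2_inner f g) \<le> 0" by (rule field_le_epsilon[where y=0, simplified])
    with f2 show ?thesis by simp
  qed
  moreover have "(\<lambda>x. 0) \<in> ?A" by (simp add: L2_zero) (simp add: L2_inner_def)
  moreover have "(\<lambda>x. f x + k x) \<in> ?A" if "f \<in> ?A" "k \<in> ?A" for f k
    using that L2_inner_add_left[of f k g] g by (simp add: L2_add)
  moreover have "(\<lambda>x. c * f x) \<in> ?A" if "f \<in> ?A" for c f
    using that by (simp add: L2_scale L2_inner_scale_left)
  moreover have "?A \<subseteq> L2_space" by blast
  ultimately show ?thesis unfolding L2_closed_subspace_def by blast
qed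

text \<open>Passing to the orthogonal complement of one fixed function extends the hypothesis from \<open>S\<close> to its
  closed span; a second pass, with the arguments swapped, extends it from \<open>T\<close>.\<close>

lemma L2_closed_spans_orthogonal:
  assumes "S \<subseteq> L2_space" "T \<subseteq> L2_space"
    and orth: "\<And>f g. f \<in> S \<Longrightarrow> g \<in> T \<Longrightarrow> L2_inner f g = 0"
    and "f \<in> L2_closed_span S" "g \<in> L2_closed_span T"
  shows "L2_inner f g = 0"
proof -
  have f2: "f \<in> L2_space" using assms(4) by (simp add: L2_closed_span_def L2_closure_def)
  have 1: "L2_inner f t = 0" if "t \<in> T" for t
  proof -
    have "L2_closed_span S \<subseteq> {f \<in> L2_space. L2_inner f t = 0}"
      by (rule L2_closed_span_subset_closed_subspace[OF L2_closed_subspace_orthogonal_complement])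
        (use assms that in auto)
    with assms(4) show ?thesis by auto
  qed
  have "L2_closed_span T \<subseteq> {k \<in> L2_space. L2_inner k f = 0}"
  proof (rule L2_closed_span_subset_closed_subspace[OF L2_closed_subspace_orthogonal_complement[OF f2]])
    show "T \<subseteq> {k \<in> L2_space. L2_inner k f = 0}"
      using 1 assms(2) L2_inner_cnj[of _ f] by (force simp: subset_iff)
  qed
  hence "L2_inner g f = 0" using assms(5) by auto
  thus ?thesis using L2_inner_cnj[of f g] by simp
qed

section \<open>Completeness, projections and orthogonal sums\<close>

text \<open>The squared distances are dominated by \<open>4 W\<^sup>2\<close>.\<close>

lemma L2_dominated_convergence:
  fixes f :: "'a::euclidean_space \<Rightarrow> complex"
  assumes F: "\<And>n. F n \<in> borel_measurable lebesgue" and f: "f \<in> borel_measurable lebesgue"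
    and W: "integrable lebesgue (\<lambda>x. (W x)\<^sup>2)"
    and lim: "AE x in lebesgue. (\<lambda>n. F n x) \<longlonglongrightarrow> f x"
    and bound: "\<And>n. AE x in lebesgue. cmod (F n x) \<le> W x"
  shows "f \<in> L2_space" and "(\<lambda>n. L2_norm (\<lambda>x. f x - F n x)) \<longlonglongrightarrow> 0"
proof -
  have AEall: "AE x in lebesgue. \<forall>n. cmod (F n x) \<le> W x"
    using bound by (simp add: AE_all_countable)
  have fW: "AE x in lebesgue. cmod (f x) \<le> W x"
    using lim AEall
  proof eventually_elim
    fix x assume "(\<lambda>n. F n x) \<longlonglongrightarrow> f x" "\<forall>n. cmod (F n x) \<le> W x"
    thus "cmod (f x) \<le> W x" by (intro LIMSEQ_le_const2[OF tendsto_norm]) auto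
  qed
  show f2: "f \<in> L2_space"
  proof (rule L2_dominatedI[OF f W])
    show "AE x in lebesgue. (cmod (f x))\<^sup>2 \<le> (W x)\<^sup>2"
      using fW by eventually_elim (simp add: power_mono)
  qed
  have "(\<lambda>n. LINT x|lebesgue. (cmod (f x - F n x))\<^sup>2) \<longlonglongrightarrow> (LINT x|(lebesgue :: 'a measure). (0::real))"
  proof (rule Bochner_Integration.integral_dominated_convergence)
    show "integrable lebesgue (\<lambda>x. 4 * (W x)\<^sup>2)" using W by simp
    show "(\<lambda>x. (cmod (f x - F n x))\<^sup>2) \<in> borel_measurable lebesgue" for n
      using F[of n] f by measurable
    show "AE x in lebesgue. (\<lambda>n. (cmod (f x - F n x))\<^sup>2) \<longlonglongrightarrow> 0"
      using lim
    proof eventually_elim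
      fix x assume "(\<lambda>n. F n x) \<longlonglongrightarrow> f x"
      hence "(\<lambda>n. (cmod (f x - F n x))\<^sup>2) \<longlonglongrightarrow> (cmod (f x - f x))\<^sup>2" by (intro tendsto_intros)
      thus "(\<lambda>n. (cmod (f x - F n x))\<^sup>2) \<longlonglongrightarrow> 0" by simp
    qed
    show "AE x in lebesgue. norm ((cmod (f x - F n x))\<^sup>2) \<le> 4 * (W x)\<^sup>2" for n
      using fW AEall
    proof eventually_elim
      fix x assume "cmod (f x) \<le> W x" "\<forall>n. cmod (F n x) \<le> W x"
      hence "cmod (f x - F n x) \<le> 2 * W x"
        using norm_triangle_ineq4[of "f x" "F n x"] by (smt (verit))
      from power_mono[OF this, of 2] show "norm ((cmod (f x - F n x))\<^sup>2) \<le> 4 * (W x)\<^sup>2"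
        by (simp add: power_mult_distrib)
    qed
  qed simp
  hence "(\<lambda>n. sqrt (LINT x|lebesgue. (cmod (f x - F n x))\<^sup>2)) \<longlonglongrightarrow> sqrt 0"
    by (intro tendsto_real_sqrt) simp
  thus "(\<lambda>n. L2_norm (\<lambda>x. f x - F n x)) \<longlonglongrightarrow> 0" by (simp add: L2_norm_def)
qed

lemma L2_closed_subspace_dominated:
  assumes "L2_closed_subspace A" "\<And>n. F n \<in> A" "f \<in> borel_measurable lebesgue"
    and "integrable lebesgue (\<lambda>x. (W x)\<^sup>2)"
    and "AE x in lebesgue. (\<lambda>n. F n x) \<longlonglongrightarrow> f x"
    and "\<And>n. AE x in lebesgue. cmod (F n x) \<le> W x"
  shows "f \<in> A"
proof (rule L2_closed_subspace_limit[OF assms(1,2)])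
  have F: "F n \<in> borel_measurable lebesgue" for n
    by (rule L2_measurable[OF L2_closed_subspaceD(1)[OF assms(1,2)]])
  note dc = L2_dominated_convergence[OF F assms(3-6)]
  show "f \<in> L2_space" by (rule dc)
  show "(\<lambda>n. L2_norm (\<lambda>x. f x - F n x)) \<longlonglongrightarrow> 0" by (rule dc)
qed

lemma L2_nn_integral:
  assumes "f \<in> L2_space"
  shows "(\<integral>\<^sup>+x. ennreal ((cmod (f x))\<^sup>2) \<partial>lebesgue) = ennreal ((L2_norm f)\<^sup>2)"
  unfolding L2_norm_power2
  by (rule nn_integral_eq_integral) (use assms in \<open>auto simp: L2_integrable\<close>)

text \<open>With \<open>d\<^sub>n = |F\<^sub>n\<^sub>+\<^sub>1 - F\<^sub>n|\<close>, the series of the \<open>2\<^sup>n d\<^sub>n\<^sup>2\<close> has a finite integral, so it converges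
  almost everywhere; there the \<open>d\<^sub>n\<close> are summable too, because \<open>2 d\<^sub>n \<le> 2\<^sup>-\<^sup>n + 2\<^sup>n d\<^sub>n\<^sup>2\<close>.\<close>

lemma AE_convergent_if_L2_fast:
  assumes F: "\<And>n. F n \<in> L2_space"
    and fast: "\<And>n. L2_norm (\<lambda>x. F (Suc n) x - F n x) \<le> (1/2) ^ n"
  shows "AE x in lebesgue. convergent (\<lambda>n. F n x)"
proof -
  define u where "u n x = 2 ^ n * (cmod (F (Suc n) x - F n x))\<^sup>2" for n x
  have m: "(\<lambda>x. ennreal (u n x)) \<in> borel_measurable lebesgue" for n
    unfolding u_def using F[THEN L2_measurable] by measurable
  have int: "(\<integral>\<^sup>+x. ennreal (u n x) \<partial>lebesgue) \<le> ennreal ((1/2) ^ n)" for n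
  proof -
    have "(\<integral>\<^sup>+x. ennreal (u n x) \<partial>lebesgue)
        = (\<integral>\<^sup>+x. ennreal (2^n) * ennreal ((cmod (F (Suc n) x - F n x))\<^sup>2) \<partial>lebesgue)"
      by (simp add: u_def ennreal_mult)
    also have "\<dots> = ennreal (2^n) * ennreal ((L2_norm (\<lambda>x. F (Suc n) x - F n x))\<^sup>2)"
      using F[THEN L2_measurable]
      by (subst nn_integral_cmult) (auto simp: L2_nn_integral[OF L2_diff[OF F F]])
    also have "\<dots> = ennreal (2^n * (L2_norm (\<lambda>x. F (Suc n) x - F n x))\<^sup>2)"
      by (simp add: ennreal_mult)
    also have "\<dots> \<le> ennreal (2^n * ((1/2)^n)\<^sup>2)"
      by (intro ennreal_leI mult_left_mono power_mono fast) (auto simp: L2_norm_nonneg)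
    also have "2^n * ((1/2)^n)\<^sup>2 = (1/2::real)^n"
      by (simp add: power_mult_distrib[symmetric] power2_eq_square flip: mult.assoc)
    finally show ?thesis .
  qed
  have "(\<integral>\<^sup>+x. (\<Sum>n. ennreal (u n x)) \<partial>lebesgue) = (\<Sum>n. \<integral>\<^sup>+x. ennreal (u n x) \<partial>lebesgue)"
    by (rule nn_integral_suminf) (rule m)
  also have "\<dots> \<le> (\<Sum>n. ennreal ((1/2) ^ n))" by (intro suminf_le int) auto
  also have "\<dots> = ennreal (\<Sum>n. (1/2) ^ n)"
    by (rule suminf_ennreal2) (auto simp: summable_geometric)
  also have "\<dots> < \<infinity>" by simp
  finally have fin: "(\<integral>\<^sup>+x. (\<Sum>n. ennreal (u n x)) \<partial>lebesgue) < \<infinity>" .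
  have "AE x in lebesgue. (\<Sum>n. ennreal (u n x)) \<noteq> \<infinity>"
  proof (rule nn_integral_PInf_AE)
    note m[measurable]
    show "(\<lambda>x. \<Sum>n. ennreal (u n x)) \<in> borel_measurable lebesgue" by measurable
  qed (use fin in simp)
  thus ?thesis
  proof eventually_elim
    fix x assume "(\<Sum>n. ennreal (u n x)) \<noteq> \<infinity>"
    hence s: "summable (\<lambda>n. u n x)"
      by (intro summable_suminf_not_top) (auto simp: u_def)
    have "summable (\<lambda>n. F (Suc n) x - F n x)"
    proof (rule summable_comparison_test)
      show "summable (\<lambda>n. (1/2) ^ n + u n x)"
        by (intro summable_add s) (simp add: summable_geometric)
      show "\<exists>N. \<forall>n\<ge>N. cmod (F (Suc n) x - F n x) \<le> (1/2) ^ n + u n x"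
      proof (intro exI allI impI)
        fix n :: nat
        define d where "d = cmod (F (Suc n) x - F n x)"
        have p: "(1/2::real)^n * 2^n = 1" by (simp flip: power_mult_distrib)
        have "0 \<le> 2 ^ n * (d - (1/2)^n)\<^sup>2" by simp
        also have "\<dots> = 2 ^ n * d\<^sup>2 - 2 * d * ((1/2)^n * 2^n) + (1/2)^n * ((1/2)^n * 2^n)"
          by (simp only: power2_diff) (simp add: algebra_simps power2_eq_square)
        finally have "2 * d \<le> (1/2)^n + 2 ^ n * d\<^sup>2" by (simp only: p)
        moreover have "d \<ge> 0" by (simp add: d_def)
        ultimately show "cmod (F (Suc n) x - F n x) \<le> (1/2) ^ n + u n x"
          by (simp add: u_def flip: d_def)
      qed
    qed
    hence "convergent (\<lambda>n. \<Sum>k<n. F (Suc k) x - F k x)" by (simp add: summable_iff_convergent)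
    hence "convergent (\<lambda>n. F n x - F 0 x)" 
      using sum_lessThan_telescope[of "\<lambda>n. F n x"] by simp
    hence "convergent (\<lambda>n. (F n x - F 0 x) + F 0 x)" by (intro convergent_add convergent_const)
    thus "convergent (\<lambda>n. F n x)" by simp
  qed
qed

text \<open>The Riesz--Fischer theorem. A fast subsequence converges almost everywhere, and by the lemma of
  Fatou its pointwise limit inherits the Cauchy estimates.\<close>

lemma L2_complete:
  fixes F :: "nat \<Rightarrow> 'a::euclidean_space \<Rightarrow> complex"
  assumes F: "\<And>n. F n \<in> L2_space"
    and Cauchy: "\<And>e. e > 0 \<Longrightarrow> \<exists>N. \<forall>m\<ge>N. \<forall>n\<ge>N. L2_norm (\<lambda>x. F m x - F n x) < e"
  shows "\<exists>f\<in>L2_space. (\<lambda>n. L2_norm (\<lambda>x. f x - F n x)) \<longlonglongrightarrow> 0"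
proof -
  have "\<forall>k. \<exists>N. \<forall>m\<ge>N. \<forall>n\<ge>N. L2_norm (\<lambda>x. F m x - F n x) < (1/2)^k"
    by (intro allI Cauchy) simp
  then obtain N where N: "\<And>k m n. m \<ge> N k \<Longrightarrow> n \<ge> N k \<Longrightarrow> L2_norm (\<lambda>x. F m x - F n x) < (1/2)^k"
    by metis
  \<comment> \<open>The partial sums make \<open>r\<close> monotone; the summand \<open>k\<close> makes it unbounded.\<close>
  define r where "r k = (\<Sum>i\<le>k. N i) + k" for k
  have rN: "r k \<ge> N k" for k
    using member_le_sum[of k "{..k}" N] by (simp add: r_def)
  have rS: "r (Suc k) \<ge> r k" for k by (simp add: r_def)
  have rk: "r k \<ge> k" for k by (simp add: r_def)
  define G where "G k = F (r k)" for k
  have G: "G k \<in> L2_space" for k by (simp add: G_def F)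
  have "AE x in lebesgue. convergent (\<lambda>n. G n x)"
  proof (rule AE_convergent_if_L2_fast[OF G])
    fix n show "L2_norm (\<lambda>x. G (Suc n) x - G n x) \<le> (1/2)^n"
      unfolding G_def using N[of n "r (Suc n)" "r n"] rN[of n] rS[of n] by simp
  qed
  define f where "f x = lim (\<lambda>n. G n x)" for x
  have Gm: "G n \<in> borel_measurable lebesgue" for n using G by (rule L2_measurable)
  have fm: "f \<in> borel_measurable lebesgue"
    unfolding f_def by (rule borel_measurable_lim_metric) (rule Gm)
  have lim: "AE x in lebesgue. (\<lambda>n. G n x) \<longlonglongrightarrow> f x"
    using \<open>AE x in lebesgue. convergent (\<lambda>n. G n x)\<close>
    by eventually_elim (simp add: f_def convergent_LIMSEQ_iff)
  have Fatou: "(\<integral>\<^sup>+x. ennreal ((cmod (f x - F m x))\<^sup>2) \<partial>lebesgue) \<le> ennreal (e\<^sup>2)"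
    if M: "\<And>m n. m \<ge> M \<Longrightarrow> n \<ge> M \<Longrightarrow> L2_norm (\<lambda>x. F m x - F n x) < e" and m: "m \<ge> M"
    for e M m
  proof -
    have "(\<integral>\<^sup>+x. ennreal ((cmod (f x - F m x))\<^sup>2) \<partial>lebesgue)
        = (\<integral>\<^sup>+x. liminf (\<lambda>n. ennreal ((cmod (G n x - F m x))\<^sup>2)) \<partial>lebesgue)"
    proof (rule nn_integral_cong_AE)
      show "AE x in lebesgue. ennreal ((cmod (f x - F m x))\<^sup>2)
              = liminf (\<lambda>n. ennreal ((cmod (G n x - F m x))\<^sup>2))"
        using lim
      proof eventually_elim
        fix x assume "(\<lambda>n. G n x) \<longlonglongrightarrow> f x"
        hence "(\<lambda>n. ennreal ((cmod (G n x - F m x))\<^sup>2)) \<longlonglongrightarrow> ennreal ((cmod (f x - F m x))\<^sup>2)"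
          by (intro tendsto_intros)
        thus "ennreal ((cmod (f x - F m x))\<^sup>2) = liminf (\<lambda>n. ennreal ((cmod (G n x - F m x))\<^sup>2))"
          by (rule lim_imp_Liminf[OF trivial_limit_sequentially, symmetric])
      qed
    qed
    also have "\<dots> \<le> liminf (\<lambda>n. \<integral>\<^sup>+x. ennreal ((cmod (G n x - F m x))\<^sup>2) \<partial>lebesgue)"
    proof (rule nn_integral_liminf)
      fix n show "(\<lambda>x. ennreal ((cmod (G n x - F m x))\<^sup>2)) \<in> borel_measurable lebesgue"
        using Gm[of n] L2_measurable[OF F[of m]] by measurable
    qed
    also have "\<dots> \<le> ennreal (e\<^sup>2)"
    proof (rule Liminf_le)
      show "\<forall>\<^sub>F n in sequentially. (\<integral>\<^sup>+x. ennreal ((cmod (G n x - F m x))\<^sup>2) \<partial>lebesgue) \<le> ennreal (e\<^sup>2)"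
        using eventually_ge_at_top[of M]
      proof eventually_elim
        fix n assume "n \<ge> M"
        hence "r n \<ge> M" using rk[of n] by simp
        from M[OF this m] have "(L2_norm (\<lambda>x. G n x - F m x))\<^sup>2 \<le> e\<^sup>2"
          unfolding G_def by (intro power_mono) (auto simp: L2_norm_nonneg)
        thus "(\<integral>\<^sup>+x. ennreal ((cmod (G n x - F m x))\<^sup>2) \<partial>lebesgue) \<le> ennreal (e\<^sup>2)"
          by (subst L2_nn_integral[OF L2_diff[OF G F]]) (rule ennreal_leI)
      qed
    qed simp
    finally show ?thesis .
  qed
  have diff: "(\<lambda>x. f x - F m x) \<in> L2_space"
    if "\<And>m n. m \<ge> M \<Longrightarrow> n \<ge> M \<Longrightarrow> L2_norm (\<lambda>x. F m x - F n x) < e" "m \<ge> M" for e M m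
  proof -
    have ms: "(\<lambda>x. f x - F m x) \<in> borel_measurable lebesgue"
      using fm L2_measurable[OF F[of m]] by (rule borel_measurable_diff)
    have "integrable lebesgue (\<lambda>x. (cmod (f x - F m x))\<^sup>2)"
    proof (rule integrableI_nonneg)
      show "(\<lambda>x. (cmod (f x - F m x))\<^sup>2) \<in> borel_measurable lebesgue" using ms by measurable
      show "(\<integral>\<^sup>+x. ennreal ((cmod (f x - F m x))\<^sup>2) \<partial>lebesgue) < \<infinity>"
        using Fatou[OF that] by (rule order.strict_trans1) simp_all
    qed simp
    with ms show ?thesis by (simp add: L2_space_def)
  qed
  have f2: "f \<in> L2_space"
    using L2_add[OF diff[where M = "N 0" and e = "(1/2)^0", OF N[of 0] order_refl] F[of "N 0"]] by simp
  have "(\<lambda>n. L2_norm (\<lambda>x. f x - F n x)) \<longlonglongrightarrow> 0"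
  proof (rule LIMSEQ_I)
    fix e :: real assume "e > 0"
    then obtain M where M: "\<And>m n. m \<ge> M \<Longrightarrow> n \<ge> M \<Longrightarrow> L2_norm (\<lambda>x. F m x - F n x) < e / 2"
      using Cauchy[of "e / 2"] by auto
    have "norm (L2_norm (\<lambda>x. f x - F m x) - 0) < e" if "m \<ge> M" for m
    proof -
      have "ennreal ((L2_norm (\<lambda>x. f x - F m x))\<^sup>2) \<le> ennreal ((e / 2)\<^sup>2)"
        using Fatou[OF M that] by (simp only: L2_nn_integral[OF L2_diff[OF f2 F]])
      hence "(L2_norm (\<lambda>x. f x - F m x))\<^sup>2 \<le> (e / 2)\<^sup>2" by (simp add: ennreal_le_iff)
      hence "L2_norm (\<lambda>x. f x - F m x) \<le> e / 2"
        by (rule power2_le_imp_le) (use \<open>e > 0\<close> in simp)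
      with \<open>e > 0\<close> show ?thesis by (simp add: L2_norm_nonneg)
    qed
    thus "\<exists>M. \<forall>m\<ge>M. norm (L2_norm (\<lambda>x. f x - F m x) - 0) < e" by blast
  qed
  with f2 show ?thesis by blast
qed

lemma L2_parallelogram:
  assumes "f \<in> L2_space" "g \<in> L2_space"
  shows "(L2_norm (\<lambda>x. f x + g x))\<^sup>2 + (L2_norm (\<lambda>x. f x - g x))\<^sup>2
       = 2 * (L2_norm f)\<^sup>2 + 2 * (L2_norm g)\<^sup>2"
proof -
  have "(L2_norm (\<lambda>x. f x + g x))\<^sup>2 + (L2_norm (\<lambda>x. f x - g x))\<^sup>2
      = (LINT x|lebesgue. (cmod (f x + g x))\<^sup>2 + (cmod (f x - g x))\<^sup>2)"
    unfolding L2_norm_power2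
    using L2_integrable[OF L2_add[OF assms]] L2_integrable[OF L2_diff[OF assms]] by simp
  also have "\<dots> = (LINT x|lebesgue. 2 * (cmod (f x))\<^sup>2 + 2 * (cmod (g x))\<^sup>2)"
    by (rule Bochner_Integration.integral_cong)
      (auto simp: cmod_power2 power2_diff power2_sum algebra_simps)
  also have "\<dots> = 2 * (L2_norm f)\<^sup>2 + 2 * (L2_norm g)\<^sup>2"
    unfolding L2_norm_power2 using assms[THEN L2_integrable] by simp
  finally show ?thesis .
qed

text \<open>By the parallelogram law a minimizing sequence for the distance from \<open>f\<close> to \<open>A\<close> is Cauchy. Its
  limit \<open>g\<close> attains the minimum \<open>D\<close> of the squared distance, and comparing \<open>g\<close> with \<open>g + c b\<close>, where
  \<open>c b\<close> is the component of \<open>f - g\<close> along \<open>b\<close>, shows that this component vanishes.\<close>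

theorem L2_projection_exists:
  fixes f :: "'a::euclidean_space \<Rightarrow> complex"
  assumes A: "L2_closed_subspace A" and f: "f \<in> L2_space"
  shows "\<exists>g\<in>A. \<forall>a\<in>A. L2_inner (\<lambda>x. f x - g x) a = 0"
proof -
  note A2 = L2_closed_subspaceD(1)[OF A]
  define D where "D = (INF a\<in>A. (L2_norm (\<lambda>x. f x - a x))\<^sup>2)"
  have bdd: "bdd_below ((\<lambda>a. (L2_norm (\<lambda>x. f x - a x))\<^sup>2) ` A)" by (rule bdd_belowI[of _ 0]) auto
  have D_le: "D \<le> (L2_norm (\<lambda>x. f x - a x))\<^sup>2" if "a \<in> A" for a
    unfolding D_def by (rule cINF_lower[OF bdd that])
  have D0: "D \<ge> 0" unfolding D_def by (rule cINF_greatest) (use L2_closed_subspaceD(2)[OF A] in auto)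
  have "\<exists>a\<in>A. (L2_norm (\<lambda>x. f x - a x))\<^sup>2 < D + 1 / Suc n" for n
    using cINF_less_iff[OF _ bdd, of "D + 1 / Suc n"] L2_closed_subspaceD(2)[OF A]
    unfolding D_def[symmetric] by fastforce
  then obtain a where a: "\<And>n. a n \<in> A" "\<And>n. (L2_norm (\<lambda>x. f x - a n x))\<^sup>2 < D + 1 / Suc n"
    by metis
  have a2: "a n \<in> L2_space" for n by (rule A2[OF a(1)])
  have diff: "(L2_norm (\<lambda>x. a m x - a n x))\<^sup>2 \<le> 2 / Suc m + 2 / Suc n" for m n
  proof -
    \<comment> \<open>The midpoint is a competitor, too; this is where convexity of \<open>A\<close> enters.\<close>
    have "(\<lambda>x. 1/2 * (a m x + a n x)) \<in> A"
      by (intro L2_closed_subspaceD(3,4)[OF A] a(1))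
    from D_le[OF this] have "4 * D \<le> (L2_norm (\<lambda>x. 2 * (f x - 1/2 * (a m x + a n x))))\<^sup>2"
      unfolding L2_norm_scale power_mult_distrib by simp
    also have "(\<lambda>x. 2 * (f x - 1/2 * (a m x + a n x))) = (\<lambda>x. (f x - a n x) + (f x - a m x))"
      by (auto simp: algebra_simps)
    finally have "4 * D \<le> (L2_norm (\<lambda>x. (f x - a n x) + (f x - a m x)))\<^sup>2" .
    moreover have "(\<lambda>x. (f x - a n x) - (f x - a m x)) = (\<lambda>x. a m x - a n x)" by auto
    ultimately show ?thesis
      using L2_parallelogram[OF L2_diff[OF f a2[of n]] L2_diff[OF f a2[of m]]] a(2)[of m] a(2)[of n]
      by simp
  qed
  have "\<exists>g\<in>L2_space. (\<lambda>n. L2_norm (\<lambda>x. g x - a n x)) \<longlonglongrightarrow> 0"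
  proof (rule L2_complete[OF a2])
    fix e :: real assume e: "e > 0"
    obtain N where N: "inverse (real (Suc N)) < e\<^sup>2 / 4" using reals_Archimedean[of "e\<^sup>2 / 4"] e by auto
    have "L2_norm (\<lambda>x. a m x - a n x) < e" if "m \<ge> N" "n \<ge> N" for m n
    proof -
      have le: "inverse (real (Suc k)) \<le> inverse (real (Suc N))" if "k \<ge> N" for k
        using that by (intro le_imp_inverse_le) auto
      have "(L2_norm (\<lambda>x. a m x - a n x))\<^sup>2 < e\<^sup>2"
        using diff[of m n, unfolded divide_inverse] le[OF that(1)] le[OF that(2)] N by linarith
      thus ?thesis using e by (simp add: power2_less_imp_less)
    qed
    thus "\<exists>N. \<forall>m\<ge>N. \<forall>n\<ge>N. L2_norm (\<lambda>x. a m x - a n x) < e" by blast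
  qed
  then obtain g where g2: "g \<in> L2_space" and g: "(\<lambda>n. L2_norm (\<lambda>x. g x - a n x)) \<longlonglongrightarrow> 0" by blast
  have gA: "g \<in> A" by (rule L2_closed_subspace_limit[OF A a(1) g2 g])
  define u where "u x = f x - g x" for x
  have u2: "u \<in> L2_space" unfolding u_def by (rule L2_diff[OF f g2])
  have "L2_norm u \<le> sqrt D"
  proof (rule LIMSEQ_le_const)
    have "(\<lambda>n. sqrt (D + 1 / Suc n) + L2_norm (\<lambda>x. g x - a n x)) \<longlonglongrightarrow> sqrt (D + 0) + 0"
      by (intro tendsto_intros g LIMSEQ_Suc[OF lim_1_over_n])
    thus "(\<lambda>n. sqrt (D + 1 / Suc n) + L2_norm (\<lambda>x. g x - a n x)) \<longlonglongrightarrow> sqrt D" by simp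
    have "L2_norm u \<le> sqrt (D + 1 / Suc n) + L2_norm (\<lambda>x. g x - a n x)" for n
    proof -
      have "L2_norm u \<le> L2_norm (\<lambda>x. f x - a n x) + L2_norm (\<lambda>x. a n x - g x)"
        unfolding u_def by (rule L2_dist_triangle[OF f a2 g2])
      moreover have "L2_norm (\<lambda>x. f x - a n x) \<le> sqrt (D + 1 / Suc n)"
        using a(2)[of n] by (intro real_le_rsqrt) simp
      ultimately show ?thesis by (simp add: L2_norm_minus_commute[of "a n"])
    qed
    thus "\<exists>N. \<forall>n\<ge>N. L2_norm u \<le> sqrt (D + 1 / Suc n) + L2_norm (\<lambda>x. g x - a n x)" by blast
  qed
  hence "(L2_norm u)\<^sup>2 \<le> (sqrt D)\<^sup>2" by (intro power_mono) (auto simp: L2_norm_nonneg)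
  hence uD: "(L2_norm u)\<^sup>2 \<le> D" using D0 by simp
  have "L2_inner u b = 0" if b: "b \<in> A" for b
  proof (cases "L2_norm b = 0")
    case True
    with L2_Cauchy_Schwarz[OF u2 A2[OF b]] show ?thesis by simp
  next
    case False
    define B where "B = (L2_norm b)\<^sup>2"
    have B: "B > 0" using False by (simp add: B_def)
    define p where "p = L2_inner u b"
    define c where "c = p / of_real B"
    have cb: "(\<lambda>x. c * b x) \<in> A" by (rule L2_closed_subspaceD(4)[OF A b])
    have "(\<lambda>x. g x + c * b x) \<in> A" by (rule L2_closed_subspaceD(3)[OF A gA cb])
    from D_le[OF this] uD have "(L2_norm u)\<^sup>2 \<le> (L2_norm (\<lambda>x. u x - c * b x))\<^sup>2"
      by (simp add: u_def diff_diff_eq)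
    also have "\<dots> = (L2_norm u)\<^sup>2 - 2 * Re (L2_inner u (\<lambda>x. c * b x)) + (cmod c)\<^sup>2 * B"
      by (simp add: L2_norm_diff_power2[OF u2 A2[OF cb]] L2_norm_scale power_mult_distrib B_def)
    also have "L2_inner u (\<lambda>x. c * b x) = cnj c * p"
      using L2_inner_cnj[of u "\<lambda>x. c * b x"] L2_inner_cnj[of u b]
      by (simp add: L2_inner_scale_left p_def)
    also have "cnj c * p = of_real ((cmod p)\<^sup>2 / B)"
      by (simp add: c_def complex_norm_square mult.commute del: of_real_power)
    also have "(cmod c)\<^sup>2 * B = (cmod p)\<^sup>2 / B"
      using B by (simp add: c_def norm_divide power_divide power2_eq_square)
    finally have "(cmod p)\<^sup>2 / B \<le> 0" by simp
    with B have "(cmod p)\<^sup>2 \<le> 0" by (simp add: divide_le_0_iff)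
    thus ?thesis by (simp add: p_def)
  qed
  with gA show ?thesis unfolding u_def by blast
qed

text \<open>The component \<open>g l\<close> is the projection of \<open>f\<close> to \<open>A l\<close>. The remainder after \<open>M\<close> terms is orthogonal to
  \<open>A k\<close> for every \<open>k < M\<close>, so by Pythagoras the partial sum is at least as close to \<open>f\<close> as any sum
  of members of these spaces, in particular as those provided by density.\<close>

theorem L2_orthogonal_sumI:
  fixes A :: "nat \<Rightarrow> ('a::euclidean_space \<Rightarrow> complex) set"
  assumes A: "\<And>l. L2_closed_subspace (A l)"
    and orth: "\<And>k l f g. k \<noteq> l \<Longrightarrow> f \<in> A k \<Longrightarrow> g \<in> A l \<Longrightarrow> L2_inner f g = 0"
    and dense: "\<And>f e. f \<in> L2_space \<Longrightarrow> e > 0 \<Longrightarrow>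
       \<exists>N p. (\<forall>l. p l \<in> A l) \<and> L2_norm (\<lambda>x. f x - (\<Sum>l<N. p l x)) < e"
  shows "L2_orthogonal_sum A"
proof -
  have "\<exists>g. (\<forall>l. g l \<in> A l) \<and> (\<lambda>N. L2_norm (\<lambda>x. f x - (\<Sum>l<N. g l x))) \<longlonglongrightarrow> 0"
    if f: "f \<in> L2_space" for f
  proof -
    obtain g where g: "\<And>l. g l \<in> A l" "\<And>l a. a \<in> A l \<Longrightarrow> L2_inner (\<lambda>x. f x - g l x) a = 0"
      using L2_projection_exists[OF A f] by metis
    have g2: "g l \<in> L2_space" for l by (rule L2_closed_subspaceD(1)[OF A g(1)])
    define R where "R N x = f x - (\<Sum>l<N. g l x)" for N x
    have R2: "R N \<in> L2_space" for N
      unfolding R_def by (intro L2_diff[OF f] L2_sum g2)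
    have R_orth: "L2_inner (R N) a = 0" if "k < N" "a \<in> A k" for N k a
    proof -
      have a2: "a \<in> L2_space" by (rule L2_closed_subspaceD(1)[OF A that(2)])
      have "L2_inner (R N) a = L2_inner f a - (\<Sum>l<N. L2_inner (g l) a)"
        unfolding R_def using a2 g2 f by (simp add: L2_inner_diff_left L2_inner_sum_left L2_sum)
      also have "(\<Sum>l<N. L2_inner (g l) a) = (\<Sum>l\<in>{k}. L2_inner (g l) a)"
        using that by (intro sum.mono_neutral_right) (auto intro: orth[OF _ g(1) that(2)])
      also have "L2_inner f a - \<dots> = L2_inner (\<lambda>x. f x - g k x) a"
        by (simp add: L2_inner_diff_left[OF f g2 a2])
      finally show ?thesis using g(2)[OF that(2)] by simp
    qed
    have "L2_norm (R M) < e" if "e > 0" and N: "\<And>l. p l \<in> A l"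
      "L2_norm (\<lambda>x. f x - (\<Sum>l<N. p l x)) < e" and "N \<le> M" for e N p M
    proof -
      define q where "q l x = g l x - (if l < N then p l x else 0)" for l x
      have pA: "(\<lambda>x. - (if l < N then p l x else 0)) \<in> A l" for l
        using L2_closed_subspaceD(4)[OF A N(1), where c = "-1"] L2_closed_subspaceD(2)[OF A, of l]
        by (cases "l < N") auto
      have qA: "q l \<in> A l" for l
        using L2_closed_subspaceD(3)[OF A g(1) pA, of l] by (simp add: q_def[abs_def])
      have q2: "q l \<in> L2_space" for l by (rule L2_closed_subspaceD(1)[OF A qA])
      \<comment> \<open>\<open>- Q\<close> is the difference between the partial sum of the \<open>g l\<close> and the approximant.\<close>
      define Q where "Q x = - (\<Sum>l<M. q l x)" for x
      have Q2: "Q \<in> L2_space"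
        unfolding Q_def using L2_scale[OF L2_sum[of "{..<M}" q, OF q2], of "-1"] by simp
      have "L2_inner (R M) Q = cnj (L2_inner Q (R M))" by (rule L2_inner_cnj)
      also have "L2_inner Q (R M) = - (\<Sum>l<M. L2_inner (q l) (R M))"
        unfolding Q_def using L2_inner_scale_left[of "-1" "\<lambda>x. \<Sum>l<M. q l x" "R M"]
        by (simp add: L2_inner_sum_left[OF q2 R2])
      also have "\<dots> = - (\<Sum>l<M. 0)"
        using R_orth[OF _ qA] L2_inner_cnj[of _ "R M"] by simp
      finally have RQ: "L2_inner (R M) Q = 0" by simp
      have "(\<lambda>x. f x - (\<Sum>l<N. p l x)) = (\<lambda>x. R M x - Q x)"
      proof
        fix x
        have "(\<Sum>l<M. if l < N then p l x else 0) = (\<Sum>l<N. p l x)"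
          using \<open>N \<le> M\<close> by (intro sum.mono_neutral_cong_right) auto
        thus "f x - (\<Sum>l<N. p l x) = R M x - Q x"
          by (simp add: R_def Q_def q_def sum_subtractf)
      qed
      hence "(L2_norm (\<lambda>x. f x - (\<Sum>l<N. p l x)))\<^sup>2 = (L2_norm (R M))\<^sup>2 + (L2_norm Q)\<^sup>2"
        using L2_norm_diff_power2[OF R2 Q2] RQ by simp
      hence "(L2_norm (R M))\<^sup>2 \<le> (L2_norm (\<lambda>x. f x - (\<Sum>l<N. p l x)))\<^sup>2" by simp
      hence "L2_norm (R M) \<le> L2_norm (\<lambda>x. f x - (\<Sum>l<N. p l x))"
        by (rule power2_le_imp_le) (rule L2_norm_nonneg)
      with N(2) show ?thesis by simp
    qed
    hence "(\<lambda>N. L2_norm (R N)) \<longlonglongrightarrow> 0"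
      by (intro LIMSEQ_I) (use dense[OF f] in \<open>simp add: L2_norm_nonneg; meson\<close>)
    with g(1) show ?thesis unfolding R_def by blast
  qed
  with A orth show ?thesis unfolding L2_orthogonal_sum_def by blast
qed

section \<open>Complex Hermite polynomials and Wirtinger derivatives\<close>

text \<open>For \<open>c = (\<mu> + i \<nu>) / 2\<close> this is the function on which the operators \<open>a\<^sup>+\<^sub>j\<close> act; the squared modulus of that
  one is the case \<open>c = \<mu>\<close>.\<close>

definition gauss :: "complex \<Rightarrow> 'a::real_normed_vector \<Rightarrow> complex" where
  "gauss c z = exp (- (c * of_real ((norm z)\<^sup>2)))"

text \<open>The complex Hermite polynomials of Ito, defined by the raising operator \<open>\<mu> cnj w - \<partial>/\<partial>w\<close> in a form free
  of derivatives. In the case \<open>s = 0\<close> the truncated \<open>s - 1\<close> is multiplied by \<open>0\<close>.\<close>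

fun ito :: "real \<Rightarrow> nat \<Rightarrow> nat \<Rightarrow> complex \<Rightarrow> complex" where
  "ito \<mu> 0 s w = w ^ s"
| "ito \<mu> (Suc r) s w = of_real \<mu> * cnj w * ito \<mu> r s w - of_nat s * ito \<mu> r (s - 1) w"

text \<open>Both Wirtinger derivatives are lowering operators: \<open>\<partial>/\<partial>w\<close> lowers \<open>s\<close>, with factor \<open>s\<close>, and
  \<open>\<partial>/\<partial>cnj w\<close> lowers \<open>r\<close>, with factor \<open>\<mu> r\<close>.\<close>

lemma ito_has_derivative:
  "(ito \<mu> r s has_derivative
     (\<lambda>d. of_nat s * ito \<mu> r (s - 1) w * d + of_real \<mu> * of_nat r * ito \<mu> (r - 1) s w * cnj d)) (at w)"
proof (induction r arbitrary: s)
  case 0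
  have "((\<lambda>w. w ^ s) has_derivative (\<lambda>d. of_nat s * w ^ (s - 1) * d)) (at w)"
    by (rule has_derivative_eq_rhs[OF has_derivative_power[OF has_derivative_ident]]) (simp add: mult_ac)
  thus ?case by (simp add: fun_eq_iff[symmetric] del: fun_eq_iff) 
next
  case (Suc r)
  have c: "(cnj has_derivative cnj) (at w)"
    using bounded_linear.has_derivative[OF bounded_linear_cnj has_derivative_ident] .
  have "((\<lambda>w. of_real \<mu> * cnj w * ito \<mu> r s w - of_nat s * ito \<mu> r (s - 1) w) has_derivative
      (\<lambda>d. of_real \<mu> * cnj w * (of_nat s * ito \<mu> r (s - 1) w * d + of_real \<mu> * of_nat r * ito \<mu> (r - 1) s w * cnj d)
          + of_real \<mu> * cnj d * ito \<mu> r s w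
          - of_nat s * (of_nat (s - 1) * ito \<mu> r (s - 1 - 1) w * d + of_real \<mu> * of_nat r * ito \<mu> (r - 1) (s - 1) w * cnj d)))
     (at w)"
    by (intro has_derivative_diff has_derivative_mult has_derivative_mult_right c Suc.IH)
  also have "(\<lambda>d. of_real \<mu> * cnj w * (of_nat s * ito \<mu> r (s - 1) w * d + of_real \<mu> * of_nat r * ito \<mu> (r - 1) s w * cnj d)
          + of_real \<mu> * cnj d * ito \<mu> r s w
          - of_nat s * (of_nat (s - 1) * ito \<mu> r (s - 1 - 1) w * d + of_real \<mu> * of_nat r * ito \<mu> (r - 1) (s - 1) w * cnj d))
      = (\<lambda>d. of_nat s * ito \<mu> (Suc r) (s - 1) w * d + of_real \<mu> * of_nat (Suc r) * ito \<mu> (Suc r - 1) s w * cnj d)"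
    by (cases r) (auto simp: fun_eq_iff algebra_simps)
  finally show ?case by simp
qed

text \<open>Multiplication by \<open>w\<close> and the raising operator \<open>\<mu> cnj w - \<partial>/\<partial>w\<close> have commutator \<open>1\<close>; moving \<open>w\<close>
  through \<open>r\<close> copies of the latter costs \<open>r\<close> terms.\<close>

lemma ito_mult_arg:
  "w * ito \<mu> r s w = ito \<mu> r (Suc s) w + of_nat r * ito \<mu> (r - 1) s w"
proof (induction r arbitrary: s)
  case (Suc r)
  have 1: "of_nat r * ito \<mu> r s w =
      of_real \<mu> * cnj w * (of_nat r * ito \<mu> (r - 1) s w) - of_nat s * (of_nat r * ito \<mu> (r - 1) (s - 1) w)"
    by (cases r) (simp_all add: algebra_simps)
  have 2: "of_nat s * (w * ito \<mu> r (s - 1) w) = of_nat s * ito \<mu> r s w + of_nat s * (of_nat r * ito \<mu> (r - 1) (s - 1) w)"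
    by (cases s) (simp_all add: Suc.IH algebra_simps)
  have "w * ito \<mu> (Suc r) s w = of_real \<mu> * cnj w * (w * ito \<mu> r s w) - of_nat s * (w * ito \<mu> r (s - 1) w)"
    by (simp add: algebra_simps)
  also have "\<dots> = ito \<mu> (Suc r) (Suc s) w + ito \<mu> r s w + of_nat r * ito \<mu> r s w"
    unfolding 1 2 Suc.IH[of s] by (simp add: algebra_simps)
  finally show ?case by (simp add: algebra_simps)
qed simp

text \<open>The indices are functions and not vectors, so that a shift in one coordinate is a function update.
  In the comments this polynomial is \<open>H\<^sub>r\<^sub>,\<^sub>s\<close>.\<close>

definition ito_prod :: "real \<Rightarrow> ('n::finite \<Rightarrow> nat) \<Rightarrow> ('n \<Rightarrow> nat) \<Rightarrow> complex ^ 'n \<Rightarrow> complex" where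
  "ito_prod \<mu> r s z = (\<Prod>j\<in>UNIV. ito \<mu> (r j) (s j) (z $ j))"

lemma ito_prod_split:
  "ito_prod \<mu> (r(j := a)) (s(j := b)) z
     = ito \<mu> a b (z $ j) * (\<Prod>i\<in>UNIV - {j}. ito \<mu> (r i) (s i) (z $ i))"
proof -
  have "ito_prod \<mu> (r(j := a)) (s(j := b)) z
     = ito \<mu> a b (z $ j) * (\<Prod>i\<in>UNIV - {j}. ito \<mu> ((r(j := a)) i) ((s(j := b)) i) (z $ i))"
    unfolding ito_prod_def by (subst prod.remove[of _ j]) auto
  also have "(\<Prod>i\<in>UNIV - {j}. ito \<mu> ((r(j := a)) i) ((s(j := b)) i) (z $ i))
     = (\<Prod>i\<in>UNIV - {j}. ito \<mu> (r i) (s i) (z $ i))"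
    by (rule prod.cong) auto
  finally show ?thesis .
qed

lemmas ito_prod_split' =
  ito_prod_split[of \<mu> r j "r j" s "s j" z for \<mu> r j s z, unfolded fun_upd_triv]
  ito_prod_split[of \<mu> r j a s "s j" z for \<mu> r j a s z, unfolded fun_upd_triv]
  ito_prod_split[of \<mu> r j "r j" s b z for \<mu> r j s b z, unfolded fun_upd_triv]

lemma ito_prod_raise_left:
  "ito_prod \<mu> (r(j := Suc (r j))) s z
     = of_real \<mu> * cnj (z $ j) * ito_prod \<mu> r s z - of_nat (s j) * ito_prod \<mu> r (s(j := s j - 1)) z"
  unfolding ito_prod_split'[where j = j] by (simp add: algebra_simps)

lemma ito_prod_raise_right:
  "ito_prod \<mu> r (s(j := Suc (s j))) z
     = z $ j * ito_prod \<mu> r s z - of_nat (r j) * ito_prod \<mu> (r(j := r j - 1)) s z"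
  unfolding ito_prod_split'[where j = j] using ito_mult_arg[of "z $ j" \<mu> "r j" "s j"]
  by (simp add: algebra_simps flip: mult.assoc)

text \<open>Here \<open>p\<close> and \<open>q\<close> are the derivatives of \<open>f\<close> by \<open>z\<^sub>j\<close> and \<open>cnj z\<^sub>j\<close>. They are kept together, because conjugation
  exchanges them.\<close>

definition has_wirtinger ::
  "'n::finite \<Rightarrow> (complex ^ 'n \<Rightarrow> complex) \<Rightarrow> (complex ^ 'n \<Rightarrow> complex) \<Rightarrow> (complex ^ 'n \<Rightarrow> complex) \<Rightarrow> bool"
where
  "has_wirtinger j f p q \<longleftrightarrow>
     (\<forall>z. ((\<lambda>w. f (z + axis j w)) has_derivative (\<lambda>d. p z * d + q z * cnj d)) (at 0))"

lemma axis_zero: "axis j 0 = 0"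
  by (simp add: vec_eq_iff axis_def)

lemma has_wirtinger_mult:
  assumes "has_wirtinger j f p q" "has_wirtinger j g p' q'"
  shows "has_wirtinger j (\<lambda>z. f z * g z) (\<lambda>z. p z * g z + f z * p' z) (\<lambda>z. q z * g z + f z * q' z)"
  unfolding has_wirtinger_def
proof
  fix z
  from assms have "((\<lambda>w. f (z + axis j w)) has_derivative (\<lambda>d. p z * d + q z * cnj d)) (at 0)"
    "((\<lambda>w. g (z + axis j w)) has_derivative (\<lambda>d. p' z * d + q' z * cnj d)) (at 0)"
    by (simp_all add: has_wirtinger_def)
  from has_derivative_mult[OF this]
  show "((\<lambda>w. f (z + axis j w) * g (z + axis j w)) has_derivative
      (\<lambda>d. (p z * g z + f z * p' z) * d + (q z * g z + f z * q' z) * cnj d)) (at 0)"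
    by (rule has_derivative_eq_rhs) (simp add: axis_zero algebra_simps)
qed

lemma has_wirtinger_cnj:
  assumes "has_wirtinger j f p q"
  shows "has_wirtinger j (\<lambda>z. cnj (f z)) (\<lambda>z. cnj (q z)) (\<lambda>z. cnj (p z))"
  unfolding has_wirtinger_def
proof
  fix z
  have "((\<lambda>w. f (z + axis j w)) has_derivative (\<lambda>d. p z * d + q z * cnj d)) (at 0)"
    using assms by (simp add: has_wirtinger_def)
  from bounded_linear.has_derivative[OF bounded_linear_cnj this]
  show "((\<lambda>w. cnj (f (z + axis j w))) has_derivative
      (\<lambda>d. cnj (q z) * d + cnj (p z) * cnj d)) (at 0)"
    by (rule has_derivative_eq_rhs) (simp add: algebra_simps)
qed

lemma has_wirtinger_directional:
  assumes "has_wirtinger j f p q"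
  shows "((\<lambda>t. f (z + t *\<^sub>R axis j v)) has_vector_derivative (p z * v + q z * cnj v)) (at 0)"
proof -
  have f: "((\<lambda>w. f (z + axis j w)) has_derivative (\<lambda>d. p z * d + q z * cnj d)) (at (0 *\<^sub>R v))"
    using assms by (simp add: has_wirtinger_def)
  have "((\<lambda>t. t *\<^sub>R v) has_derivative (\<lambda>t. t *\<^sub>R v)) (at (0::real))"
    by (auto intro!: derivative_eq_intros)
  from has_derivative_compose[where g = "\<lambda>w. f (z + axis j w)", OF this f]
  have "((\<lambda>t. f (z + axis j (t *\<^sub>R v))) has_derivative (\<lambda>t. p z * (t *\<^sub>R v) + q z * cnj (t *\<^sub>R v))) (at 0)" .
  moreover have "axis j (t *\<^sub>R v) = t *\<^sub>R axis j v" for t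
    by (simp add: vec_eq_iff axis_def)
  ultimately show ?thesis unfolding has_vector_derivative_def
    by (simp add: scaleR_conv_of_real algebra_simps)
qed

lemma partial_z_eq:
  assumes "has_wirtinger j f p q"
  shows "partial_z j f z = p z"
proof -
  have v: "vector_derivative (\<lambda>t. f (z + t *\<^sub>R axis j v)) (at 0) = p z * v + q z * cnj v" for v
    by (rule vector_derivative_at[OF has_wirtinger_directional[OF assms]])
  show ?thesis unfolding partial_z_def v by (simp add: algebra_simps flip: mult.assoc)
qed

lemma has_wirtinger_ito_prod:
  "has_wirtinger j (ito_prod \<mu> r s)
     (\<lambda>z. of_nat (s j) * ito_prod \<mu> r (s(j := s j - 1)) z)
     (\<lambda>z. of_real \<mu> * of_nat (r j) * ito_prod \<mu> (r(j := r j - 1)) s z)"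
  unfolding has_wirtinger_def
proof
  fix z :: "complex ^ 'a"
  define K where "K = (\<Prod>i\<in>UNIV - {j}. ito \<mu> (r i) (s i) (z $ i))"
  have K: "(\<Prod>i\<in>UNIV - {j}. ito \<mu> (r i) (s i) ((z + axis j w) $ i)) = K" for w
    unfolding K_def by (rule prod.cong) (auto simp: axis_def)
  have "((\<lambda>w. ito \<mu> (r j) (s j) (z $ j + w)) has_derivative
      (\<lambda>d. of_nat (s j) * ito \<mu> (r j) (s j - 1) (z $ j) * d
         + of_real \<mu> * of_nat (r j) * ito \<mu> (r j - 1) (s j) (z $ j) * cnj d)) (at 0)"
  proof (rule has_derivative_compose[where f = "\<lambda>w. z $ j + w" and f' = "\<lambda>d. d"])
    show "((\<lambda>w. z $ j + w) has_derivative (\<lambda>d. d)) (at 0)" by (auto intro!: derivative_eq_intros)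
  qed (use ito_has_derivative[of \<mu> "r j" "s j" "z $ j"] in simp)
  from has_derivative_mult_left[OF this, of K]
  show "((\<lambda>w. ito_prod \<mu> r s (z + axis j w)) has_derivative
       (\<lambda>d. of_nat (s j) * ito_prod \<mu> r (s(j := s j - 1)) z * d
          + of_real \<mu> * of_nat (r j) * ito_prod \<mu> (r(j := r j - 1)) s z * cnj d)) (at 0)"
    unfolding ito_prod_split'[where j = j] K unfolding K_def
    by (simp add: axis_def algebra_simps)
qed

lemma norm_vec_power2: "of_real ((norm z)\<^sup>2) = (\<Sum>i\<in>UNIV. z $ i * cnj (z $ i))" for z :: "complex ^ 'n::finite"
  by (simp add: norm_vec_def L2_set_def sum_nonneg complex_norm_square flip: of_real_power)

lemma norm_add_axis_power2:
  "of_real ((norm (z + axis j w))\<^sup>2)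
     = of_real ((norm z)\<^sup>2) + cnj (z $ j) * w + z $ j * cnj w + w * cnj w"
  for z :: "complex ^ 'n::finite"
proof -
  have "(\<Sum>i\<in>UNIV. (z + axis j w) $ i * cnj ((z + axis j w) $ i))
     = (\<Sum>i\<in>UNIV. z $ i * cnj (z $ i) + (if i = j then cnj (z $ j) * w + z $ j * cnj w + w * cnj w else 0))"
    by (rule sum.cong) (auto simp: axis_def algebra_simps)
  also have "\<dots> = (\<Sum>i\<in>UNIV. z $ i * cnj (z $ i)) + (cnj (z $ j) * w + z $ j * cnj w + w * cnj w)"
    by (simp add: sum.distrib)
  finally show ?thesis by (simp only: norm_vec_power2 add.assoc)
qed

lemma has_wirtinger_gauss:
  "has_wirtinger j (gauss c) (\<lambda>z. - c * cnj (z $ j) * gauss c z) (\<lambda>z. - c * z $ j * gauss c z)"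
  unfolding has_wirtinger_def
proof
  fix z :: "complex ^ 'a"
  note cn = bounded_linear.has_derivative[OF bounded_linear_cnj]
  let ?e = "\<lambda>w. - (c * (of_real ((norm z)\<^sup>2) + cnj (z $ j) * w + z $ j * cnj w + w * cnj w))"
  have "(?e has_derivative (\<lambda>d. - c * (cnj (z $ j) * d + z $ j * cnj d))) (at 0)"
    by (auto intro!: derivative_eq_intros cn simp: algebra_simps)
  moreover have "(exp has_derivative (\<lambda>d. gauss c z * d)) (at (?e 0))"
    using DERIV_exp[of "?e 0"] by (simp add: has_field_derivative_def gauss_def)
  ultimately have "((\<lambda>w. exp (?e w)) has_derivative
      (\<lambda>d. gauss c z * (- c * (cnj (z $ j) * d + z $ j * cnj d)))) (at 0)"
    by (rule has_derivative_compose)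
  thus "((\<lambda>w. gauss c (z + axis j w)) has_derivative
     (\<lambda>d. - c * cnj (z $ j) * gauss c z * d + - c * z $ j * gauss c z * cnj d)) (at 0)"
    unfolding gauss_def norm_add_axis_power2 by (simp add: algebra_simps)
qed

text \<open>The derivative of the Gaussian contributes \<open>c cnj z\<^sub>j\<close>, and \<open>c + (\<mu> - i \<nu>) / 2 = \<mu>\<close>.\<close>

lemma a_plus_ito_prod_gauss:
  assumes c: "c = (of_real \<mu> + \<i> * of_real \<nu>) / 2"
  shows "a_plus \<nu> \<mu> j (\<lambda>z. ito_prod \<mu> r s z * gauss c z)
       = (\<lambda>z. ito_prod \<mu> (r(j := Suc (r j))) s z * gauss c z)"
proof
  fix z
  define d where "d = (of_real \<mu> - \<i> * of_real \<nu>) / 2"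
  have m: "of_real \<mu> = c + d" by (simp add: c d_def field_simps)
  show "a_plus \<nu> \<mu> j (\<lambda>z. ito_prod \<mu> r s z * gauss c z) z
       = ito_prod \<mu> (r(j := Suc (r j))) s z * gauss c z"
    unfolding a_plus_def ito_prod_raise_left d_def[symmetric]
      partial_z_eq[OF has_wirtinger_mult[OF has_wirtinger_ito_prod has_wirtinger_gauss]]
    unfolding m by (simp add: algebra_simps)
qed

lemma a_plus_power_ito_prod_gauss:
  assumes c: "c = (of_real \<mu> + \<i> * of_real \<nu>) / 2"
  shows "(a_plus \<nu> \<mu> j ^^ k) (\<lambda>z. ito_prod \<mu> r s z * gauss c z)
       = (\<lambda>z. ito_prod \<mu> (r(j := r j + k)) s z * gauss c z)"
proof (induction k)
  case (Suc k)
  show ?case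
    unfolding funpow.simps o_apply Suc.IH a_plus_ito_prod_gauss[OF c]
    by (simp only: fun_upd_same fun_upd_upd add_Suc_right)
qed simp

theorem h_fun_eq:
  "h_fun \<nu> \<mu> r s = (\<lambda>z. ito_prod \<mu> (($) r) (($) s) z * gauss ((of_real \<mu> + \<i> * of_real \<nu>) / 2) z)"
proof -
  define c where "c = (of_real \<mu> + \<i> * of_real \<nu>) / 2"
  have "foldr (\<lambda>j. a_plus \<nu> \<mu> j ^^ (r $ j)) xs (\<lambda>z. ito_prod \<mu> (\<lambda>_. 0) (($) s) z * gauss c z)
      = (\<lambda>z. ito_prod \<mu> (\<lambda>j. if j \<in> set xs then r $ j else 0) (($) s) z * gauss c z)"
    if "distinct xs" for xs
    using that
  proof (induction xs)
    case (Cons x xs)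
    have "(\<lambda>j. if j \<in> set xs then r $ j else 0)(x := (if x \<in> set xs then r $ x else 0) + r $ x)
        = (\<lambda>j. if j \<in> set (x # xs) then r $ j else 0)"
      using Cons.prems by (auto simp: fun_eq_iff)
    with Cons show ?case by (simp add: a_plus_power_ito_prod_gauss[OF c_def])
  qed simp
  from this[of "sorted_list_of_set UNIV"]
  show ?thesis unfolding h_fun_def c_def[symmetric]
    by (simp add: ito_prod_def mpow_def gauss_def)
qed

section \<open>Gaussian weights and integration by parts\<close>

text \<open>The bound for every \<open>\<epsilon>\<close> makes this class stable under products, while it still contains the functions
  \<open>exp (a |z|)\<close> next to all polynomials. A member times any Gaussian is integrable and square-integrable.\<close>

definition subgaussian :: "('a::euclidean_space \<Rightarrow> complex) \<Rightarrow> bool" where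
  "subgaussian f \<longleftrightarrow> continuous_on UNIV f \<and>
     (\<forall>\<epsilon>>0. \<exists>C. \<forall>z. cmod (f z) \<le> C * exp (\<epsilon> * (norm z)\<^sup>2))"

lemma subgaussian_const: "subgaussian (\<lambda>z. a)"
  unfolding subgaussian_def
proof (intro conjI allI impI)
  fix \<epsilon> :: real assume "\<epsilon> > 0"
  show "\<exists>C. \<forall>z::'a. cmod a \<le> C * exp (\<epsilon> * (norm z)\<^sup>2)"
  proof (intro exI allI)
    fix z :: 'a
    show "cmod a \<le> cmod a * exp (\<epsilon> * (norm z)\<^sup>2)"
      using \<open>\<epsilon> > 0\<close> by (simp add: mult_le_cancel_left1)
  qed
qed (rule continuous_on_const)

lemma subgaussian_mult:
  assumes "subgaussian f" "subgaussian g"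
  shows "subgaussian (\<lambda>z. f z * g z)"
  unfolding subgaussian_def
proof (intro conjI allI impI)
  show "continuous_on UNIV (\<lambda>z. f z * g z)"
    using assms by (auto simp: subgaussian_def intro: continuous_on_mult)
  fix \<epsilon> :: real assume "\<epsilon> > 0"
  hence "\<epsilon> / 2 > 0" by simp
  with assms obtain C D where C: "\<And>z. cmod (f z) \<le> C * exp (\<epsilon> / 2 * (norm z)\<^sup>2)"
    and D: "\<And>z. cmod (g z) \<le> D * exp (\<epsilon> / 2 * (norm z)\<^sup>2)"
    unfolding subgaussian_def by meson
  have "cmod (f z * g z) \<le> (C * D) * exp (\<epsilon> * (norm z)\<^sup>2)" for z
  proof -
    have "cmod (f z * g z) \<le> (C * exp (\<epsilon> / 2 * (norm z)\<^sup>2)) * (D * exp (\<epsilon> / 2 * (norm z)\<^sup>2))"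
      unfolding norm_mult by (rule mult_mono[OF C D order_trans[OF norm_ge_zero C] norm_ge_zero])
    also have "\<dots> = (C * D) * exp (\<epsilon> / 2 * (norm z)\<^sup>2 + \<epsilon> / 2 * (norm z)\<^sup>2)"
      by (simp only: exp_add mult_ac)
    finally show ?thesis by simp
  qed
  thus "\<exists>C. \<forall>z. cmod (f z * g z) \<le> C * exp (\<epsilon> * (norm z)\<^sup>2)" by blast
qed

lemma subgaussian_add:
  assumes "subgaussian f" "subgaussian g"
  shows "subgaussian (\<lambda>z. f z + g z)"
  unfolding subgaussian_def
proof (intro conjI allI impI)
  show "continuous_on UNIV (\<lambda>z. f z + g z)"
    using assms by (auto simp: subgaussian_def intro: continuous_on_add)
  fix \<epsilon> :: real assume "\<epsilon> > 0"
  with assms obtain C D where C: "\<And>z. cmod (f z) \<le> C * exp (\<epsilon> * (norm z)\<^sup>2)"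
    and D: "\<And>z. cmod (g z) \<le> D * exp (\<epsilon> * (norm z)\<^sup>2)"
    unfolding subgaussian_def by meson
  have "cmod (f z + g z) \<le> (C + D) * exp (\<epsilon> * (norm z)\<^sup>2)" for z
    using norm_triangle_ineq[of "f z" "g z"] C[of z] D[of z] by (simp add: distrib_right)
  thus "\<exists>C. \<forall>z. cmod (f z + g z) \<le> C * exp (\<epsilon> * (norm z)\<^sup>2)" by blast
qed

lemma subgaussian_diff:
  assumes "subgaussian f" "subgaussian g"
  shows "subgaussian (\<lambda>z. f z - g z)"
  using subgaussian_add[OF assms(1) subgaussian_mult[OF subgaussian_const[of "-1"] assms(2)]] by simp

lemma subgaussian_bound:
  assumes "subgaussian f" "continuous_on UNIV g" "\<And>z. cmod (g z) \<le> cmod (f z)"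
  shows "subgaussian g"
  using assms unfolding subgaussian_def by (meson order_trans)

lemma subgaussian_cnj: "subgaussian f \<Longrightarrow> subgaussian (\<lambda>z. cnj (f z))"
  by (rule subgaussian_bound[of f]) (auto simp: subgaussian_def intro: continuous_on_cnj)

lemma subgaussian_power: "subgaussian f \<Longrightarrow> subgaussian (\<lambda>z. f z ^ n)"
  by (induction n) (auto intro: subgaussian_const subgaussian_mult)

lemma subgaussian_prod: "(\<And>i. i \<in> I \<Longrightarrow> subgaussian (f i)) \<Longrightarrow> subgaussian (\<lambda>z. \<Prod>i\<in>I. f i z)"
  by (induction I rule: infinite_finite_induct) (auto intro: subgaussian_const subgaussian_mult)

text \<open>From \<open>(a - 2 \<epsilon> |z|)\<^sup>2 \<ge> 0\<close>.\<close>

lemma subgaussian_exp_norm: "subgaussian (\<lambda>z::'a::euclidean_space. of_real (exp (a * norm z)))"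
  unfolding subgaussian_def
proof (intro conjI allI impI)
  show "continuous_on UNIV (\<lambda>z::'a. complex_of_real (exp (a * norm z)))"
    by (intro continuous_intros)
  fix \<epsilon> :: real assume e: "\<epsilon> > 0"
  have "cmod (of_real (exp (a * norm z))) \<le> exp (a\<^sup>2 / (4 * \<epsilon>)) * exp (\<epsilon> * (norm z)\<^sup>2)" for z :: 'a
  proof -
    have "0 \<le> (a - 2 * \<epsilon> * norm z)\<^sup>2 / (4 * \<epsilon>)" using e by simp
    also have "\<dots> = a\<^sup>2 / (4 * \<epsilon>) + \<epsilon> * (norm z)\<^sup>2 - a * norm z"
      using e by (simp add: power2_eq_square field_simps)
    finally show ?thesis by (simp add: exp_add[symmetric])
  qed
  thus "\<exists>C. \<forall>z::'a. cmod (of_real (exp (a * norm z))) \<le> C * exp (\<epsilon> * (norm z)\<^sup>2)" by blast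
qed

lemma subgaussian_coord: "subgaussian (\<lambda>z::complex ^ 'n::finite. z $ j)"
proof (rule subgaussian_bound[OF subgaussian_exp_norm[of 1]])
  show "continuous_on UNIV (\<lambda>z::complex ^ 'n. z $ j)" by (intro continuous_intros)
  fix z :: "complex ^ 'n"
  have "cmod (z $ j) \<le> norm z" by (rule Finite_Cartesian_Product.norm_nth_le)
  also have "\<dots> \<le> exp (norm z)" using exp_ge_add_one_self[of "norm z"] by linarith
  finally show "cmod (z $ j) \<le> cmod (of_real (exp (1 * norm z)))" by simp
qed

lemma subgaussian_ito: "subgaussian (\<lambda>z::complex ^ 'n::finite. ito \<mu> r s (z $ j))"
proof (induction r arbitrary: s)
  case 0 show ?case by (simp add: subgaussian_power subgaussian_coord)
next
  case (Suc r)
  show ?case unfolding ito.simps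
    by (intro subgaussian_diff subgaussian_mult subgaussian_const subgaussian_cnj subgaussian_coord Suc.IH)
qed

lemma subgaussian_ito_prod: "subgaussian (ito_prod \<mu> r s)"
  unfolding ito_prod_def[abs_def] by (intro subgaussian_prod subgaussian_ito)

lemma norm_gauss: "cmod (gauss c z) = exp (- (Re c * (norm z)\<^sup>2))"
  by (simp add: gauss_def norm_exp_eq_Re flip: of_real_power)

lemma continuous_on_gauss: "continuous_on S (gauss c)"
  unfolding gauss_def[abs_def] by (intro continuous_intros)

lemma integrable_gaussian_real:
  assumes "b > 0" shows "integrable lborel (\<lambda>x::real. exp (- (b * x\<^sup>2)))"
proof -
  define \<sigma> where "\<sigma> = sqrt (1 / (2 * b))"
  have s: "2 * \<sigma>\<^sup>2 = 1 / b" "\<sigma> > 0" using assms by (simp_all add: \<sigma>_def)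
  have "exp (- (b * x\<^sup>2)) = sqrt (2 * pi * \<sigma>\<^sup>2) * normal_density 0 \<sigma> x" for x
    using s assms by (simp add: normal_density_def mult.commute)
  thus ?thesis using integrable_normal_density[OF s(2), of 0] by simp
qed

lemma integrable_gaussian:
  assumes b: "b > 0"
  shows "integrable lebesgue (\<lambda>x::'a::euclidean_space. exp (- (b * (norm x)\<^sup>2)))"
proof -
  have m: "(\<lambda>x::'a. exp (- (b * (norm x)\<^sup>2))) \<in> borel_measurable borel" by measurable
  have "(\<integral>\<^sup>+x. ennreal (exp (- (b * (norm x)\<^sup>2))) \<partial>(lborel :: 'a measure))
      = (\<integral>\<^sup>+x. (\<Prod>i\<in>Basis. ennreal (exp (- (b * (x \<bullet> i)\<^sup>2)))) \<partial>(lborel :: 'a measure))"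
  proof (rule nn_integral_cong)
    fix x :: 'a
    have "(norm x)\<^sup>2 = (\<Sum>i\<in>Basis. (x \<bullet> i)\<^sup>2)"
      by (subst power2_norm_eq_inner, subst euclidean_inner) (simp add: power2_eq_square)
    hence "exp (- (b * (norm x)\<^sup>2)) = (\<Prod>i\<in>Basis. exp (- (b * (x \<bullet> i)\<^sup>2)))"
      by (simp add: exp_sum sum_distrib_left flip: sum_negf)
    thus "ennreal (exp (- (b * (norm x)\<^sup>2))) = (\<Prod>i\<in>Basis. ennreal (exp (- (b * (x \<bullet> i)\<^sup>2))))"
      by (simp add: prod_ennreal)
  qed
  also have "\<dots> = (\<Prod>i\<in>(Basis::'a set). \<integral>\<^sup>+x. ennreal (exp (- (b * x\<^sup>2))) \<partial>lborel)"
    by (rule nn_integral_lborel_prod) auto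
  also have "(\<integral>\<^sup>+x. ennreal (exp (- (b * x\<^sup>2))) \<partial>lborel) = ennreal (LBINT x. exp (- (b * x\<^sup>2)))"
    by (rule nn_integral_eq_integral[OF integrable_gaussian_real[OF b]]) simp
  also have "(\<Prod>i\<in>(Basis::'a set). ennreal (LBINT x. exp (- (b * x\<^sup>2)))) < \<infinity>"
    by (simp add: power_less_top_ennreal)
  finally have "integrable lborel (\<lambda>x::'a. exp (- (b * (norm x)\<^sup>2)))"
    by (intro integrableI_nonneg) (use m in auto)
  with m show ?thesis by (simp add: integrable_completion)
qed

lemma subgaussian_gauss_bound:
  assumes "subgaussian f" "Re c > 0"
  shows "\<exists>C. \<forall>z. cmod (f z * gauss c z) \<le> C * exp (- (Re c / 2 * (norm z)\<^sup>2))"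
proof -
  have "Re c / 2 > 0" using assms(2) by simp
  with assms(1) obtain C where C: "\<And>z. cmod (f z) \<le> C * exp (Re c / 2 * (norm z)\<^sup>2)"
    unfolding subgaussian_def by meson
  have "cmod (f z * gauss c z) \<le> C * exp (- (Re c / 2 * (norm z)\<^sup>2))" for z
  proof -
    have "cmod (f z * gauss c z) \<le> (C * exp (Re c / 2 * (norm z)\<^sup>2)) * exp (- (Re c * (norm z)\<^sup>2))"
      unfolding norm_mult norm_gauss by (intro mult_right_mono C) simp
    also have "\<dots> = C * exp (Re c / 2 * (norm z)\<^sup>2 + - (Re c * (norm z)\<^sup>2))"
      unfolding exp_add by simp
    also have "Re c / 2 * (norm z)\<^sup>2 + - (Re c * (norm z)\<^sup>2) = - (Re c / 2 * (norm z)\<^sup>2)" by simp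
    finally show ?thesis .
  qed
  thus ?thesis by blast
qed

lemma continuous_on_subgaussian_gauss: "subgaussian f \<Longrightarrow> continuous_on UNIV (\<lambda>z. f z * gauss c z)"
  by (auto simp: subgaussian_def intro: continuous_on_mult continuous_on_gauss)

lemma borel_measurable_lebesgue_continuous:
  "continuous_on UNIV f \<Longrightarrow> f \<in> borel_measurable lebesgue"
  for f :: "'a::euclidean_space \<Rightarrow> complex"
  using measurable_completion[of f lborel borel] by (simp add: borel_measurable_continuous_onI)

lemma integrable_subgaussian_gauss:
  assumes "subgaussian f" "Re c > 0"
  shows "integrable lebesgue (\<lambda>z. f z * gauss c z)"
proof -
  from subgaussian_gauss_bound[OF assms] obtain C
    where C: "\<And>z. cmod (f z * gauss c z) \<le> C * exp (- (Re c / 2 * (norm z)\<^sup>2))" by blast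
  show ?thesis
  proof (rule Bochner_Integration.integrable_bound)
    show "integrable lebesgue (\<lambda>z::'a. C * exp (- (Re c / 2 * (norm z)\<^sup>2)))"
      by (intro integrable_mult_right integrable_gaussian) (use assms(2) in simp)
    show "(\<lambda>z. f z * gauss c z) \<in> borel_measurable lebesgue"
      by (intro borel_measurable_lebesgue_continuous continuous_on_subgaussian_gauss assms)
    show "AE z in lebesgue. cmod (f z * gauss c z) \<le> norm (C * exp (- (Re c / 2 * (norm z)\<^sup>2)))"
      using C by (intro always_eventually allI order_trans[OF C]) (simp add: abs_ge_self)
  qed
qed

lemma gauss_mult: "gauss c z * gauss d z = gauss (c + d) z"
  by (simp add: gauss_def algebra_simps flip: exp_add)

lemma cnj_gauss: "cnj (gauss c z) = gauss (cnj c) z"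
  by (simp add: gauss_def exp_cnj)

lemma L2_subgaussian_gauss:
  assumes "subgaussian f" "Re c > 0"
  shows "(\<lambda>z. f z * gauss c z) \<in> L2_space"
proof (rule L2_dominatedI)
  show "(\<lambda>z. f z * gauss c z) \<in> borel_measurable lebesgue"
    by (intro borel_measurable_lebesgue_continuous continuous_on_subgaussian_gauss assms)
  have "integrable lebesgue (\<lambda>z. (f z * f z) * gauss (c + c) z)"
    by (rule integrable_subgaussian_gauss[OF subgaussian_mult]) (use assms in auto)
  from integrable_norm[OF this]
  show "integrable lebesgue (\<lambda>z. cmod ((f z * f z) * gauss (c + c) z))" .
  have "(cmod (f z * gauss c z))\<^sup>2 = cmod ((f z * f z) * gauss (c + c) z)" for z
    by (simp only: gauss_mult[symmetric] norm_mult power2_eq_square mult_ac)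
  thus "AE z in lebesgue. (cmod (f z * gauss c z))\<^sup>2 \<le> cmod ((f z * f z) * gauss (c + c) z)" by simp
qed

lemma lebesgue_integral_translation:
  fixes f :: "'a::euclidean_space \<Rightarrow> complex"
  assumes "continuous_on UNIV f"
  shows "(LINT x|lebesgue. f (x + v)) = (LINT x|lebesgue. f x)"
    and "integrable lebesgue f \<Longrightarrow> integrable lebesgue (\<lambda>x. f (x + v))"
proof -
  have f: "f \<in> borel_measurable borel" using assms by (rule borel_measurable_continuous_onI)
  have fv: "(\<lambda>x. f (x + v)) \<in> borel_measurable borel" using f by measurable
  have d: "(lborel :: 'a measure) = distr lborel borel ((+) v)" by (simp add: lborel_distr_plus)
  have "(LINT x|lborel. f x) = (LINT x|distr lborel borel ((+) v). f x)" by (subst d) (rule refl)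
  also have "\<dots> = (LINT x|lborel. f (v + x))" by (rule integral_distr) (use f in auto)
  finally show "(LINT x|lebesgue. f (x + v)) = (LINT x|lebesgue. f x)"
    using f fv by (simp add: integral_completion add.commute)
  have "integrable lborel f \<longleftrightarrow> integrable (distr lborel borel ((+) v)) f" by (subst d) (rule refl)
  also have "\<dots> \<longleftrightarrow> integrable lborel (\<lambda>x. f (v + x))" by (rule integrable_distr_eq) (use f in auto)
  finally show "integrable lebesgue f \<Longrightarrow> integrable lebesgue (\<lambda>x. f (x + v))"
    using f fv by (simp add: integrable_completion add.commute)
qed

text \<open>The difference quotients of \<open>F\<close> have integral \<open>0\<close> by translation invariance. By the mean value
  inequality they are dominated by a Gaussian, since a unit piece of the line through \<open>z\<close> in
  direction \<open>v\<close> changes the bound on \<open>F'\<close> only by a constant factor and half of the exponent.\<close>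

lemma integral_directional_derivative_zero:
  fixes F F' :: "'a::euclidean_space \<Rightarrow> complex"
  assumes der: "\<And>z. ((\<lambda>t. F (z + t *\<^sub>R v)) has_vector_derivative F' z) (at 0)"
    and cont: "continuous_on UNIV F" "continuous_on UNIV F'"
    and int: "integrable lebesgue F"
    and b: "b > 0" and bound: "\<And>z. cmod (F' z) \<le> C * exp (- (b * (norm z)\<^sup>2))"
  shows "(LINT z|lebesgue. F' z) = 0"
proof -
  define D where "D n z = of_real (real (Suc n)) * (F (z + (1 / real (Suc n)) *\<^sub>R v) - F z)" for n z
  have der': "((\<lambda>t. F (z + t *\<^sub>R v)) has_vector_derivative F' (z + t *\<^sub>R v)) (at t)" for z t
  proof -
    have "((\<lambda>s. s - t) has_vector_derivative 1) (at t)" by (auto intro!: derivative_eq_intros)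
    moreover have "((\<lambda>h. F ((z + t *\<^sub>R v) + h *\<^sub>R v)) has_vector_derivative F' (z + t *\<^sub>R v)) (at (t - t))"
      using der[of "z + t *\<^sub>R v"] by simp
    ultimately show ?thesis
      by (rule vector_diff_chain_at[THEN back_subst[of "\<lambda>x. x"]]) (simp add: o_def algebra_simps)
  qed
  \<comment> \<open>From \<open>|z|\<^sup>2 \<le> 2 |z + t v|\<^sup>2 + 2 |v|\<^sup>2\<close> for \<open>0 \<le> t \<le> 1\<close>.\<close>
  define W where "W z = \<bar>C\<bar> * exp (b * (norm v)\<^sup>2) * exp (- (b / 2 * (norm z)\<^sup>2))" for z :: 'a
  have W: "cmod (F' (z + t *\<^sub>R v)) \<le> W z" if t: "t \<in> {0..1}" for z t
  proof -
    have "(norm z)\<^sup>2 \<le> (norm (z + t *\<^sub>R v) + norm v)\<^sup>2"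
    proof (rule power_mono)
      have "norm z \<le> norm (z + t *\<^sub>R v) + norm (t *\<^sub>R v)"
        using norm_triangle_ineq4[of "z + t *\<^sub>R v" "t *\<^sub>R v"] by simp
      also have "norm (t *\<^sub>R v) \<le> norm v" using t by (simp add: mult_left_le_one_le)
      finally show "norm z \<le> norm (z + t *\<^sub>R v) + norm v" by simp
    qed simp
    also have "\<dots> \<le> 2 * (norm (z + t *\<^sub>R v))\<^sup>2 + 2 * (norm v)\<^sup>2"
      using sum_squares_bound[of "norm (z + t *\<^sub>R v)" "norm v"] by (simp add: power2_sum)
    finally have "b / 2 * (norm z)\<^sup>2 \<le> b / 2 * (2 * (norm (z + t *\<^sub>R v))\<^sup>2 + 2 * (norm v)\<^sup>2)"
      using b by (intro mult_left_mono) auto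
    hence "- (b * (norm (z + t *\<^sub>R v))\<^sup>2) \<le> b * (norm v)\<^sup>2 + - (b / 2 * (norm z)\<^sup>2)"
      by (simp add: algebra_simps)
    hence e: "exp (- (b * (norm (z + t *\<^sub>R v))\<^sup>2)) \<le> exp (b * (norm v)\<^sup>2) * exp (- (b / 2 * (norm z)\<^sup>2))"
      by (simp flip: exp_add)
    have "cmod (F' (z + t *\<^sub>R v)) \<le> C * exp (- (b * (norm (z + t *\<^sub>R v))\<^sup>2))" by (rule bound)
    also have "\<dots> \<le> \<bar>C\<bar> * exp (- (b * (norm (z + t *\<^sub>R v))\<^sup>2))" by (intro mult_right_mono) auto
    also have "\<dots> \<le> W z" unfolding W_def mult.assoc by (intro mult_left_mono e) auto
    finally show ?thesis .
  qed
  have D_bound: "cmod (D n z) \<le> W z" for n z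
  proof -
    let ?h = "1 / real (Suc n)"
    have h: "?h \<in> {0..1}" by simp
    have "norm (F (z + ?h *\<^sub>R v) - F (z + 0 *\<^sub>R v)) \<le> W z * norm (?h - 0)"
    proof (rule differentiable_bound[of "{0..1}" "\<lambda>t. F (z + t *\<^sub>R v)" "\<lambda>t h. h *\<^sub>R F' (z + t *\<^sub>R v)"])
      show "((\<lambda>t. F (z + t *\<^sub>R v)) has_derivative (\<lambda>h. h *\<^sub>R F' (z + t *\<^sub>R v))) (at t within {0..1})" for t
        using der'[of z t] has_derivative_at_withinI unfolding has_vector_derivative_def by blast
      show "onorm (\<lambda>h. h *\<^sub>R F' (z + t *\<^sub>R v)) \<le> W z" if "t \<in> {0..1}" for t
        using W[OF that, of z] by (intro onorm_le) (simp add: mult.commute[of "W z"] mult_left_mono)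
    qed (use h in auto)
    hence "cmod (F (z + ?h *\<^sub>R v) - F z) \<le> W z * ?h" by simp
    hence "real (Suc n) * cmod (F (z + ?h *\<^sub>R v) - F z) \<le> real (Suc n) * (W z * ?h)"
      by (intro mult_left_mono) auto
    also have "\<dots> = W z" by simp
    finally show ?thesis by (simp only: D_def norm_mult norm_of_real abs_of_nat)
  qed
  have D_lim: "(\<lambda>n. D n z) \<longlonglongrightarrow> F' z" for z
  proof -
    have "((\<lambda>t. norm (F (z + t *\<^sub>R v) - F z - t *\<^sub>R F' z) / norm t) \<longlongrightarrow> 0) (at 0)"
      using der[of z] by (simp add: has_vector_derivative_def has_derivative_at)
    moreover have "filterlim (\<lambda>n. 1 / real (Suc n)) (at 0) sequentially"
    proof (rule filterlim_atI)
      show "(\<lambda>n. 1 / real (Suc n)) \<longlonglongrightarrow> 0" by (rule LIMSEQ_Suc[OF lim_1_over_n])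
    qed simp
    ultimately have lim: "(\<lambda>n. norm (F (z + (1 / real (Suc n)) *\<^sub>R v) - F z - (1 / real (Suc n)) *\<^sub>R F' z)
        / norm (1 / real (Suc n))) \<longlonglongrightarrow> 0"
      by (rule filterlim_compose)
    have "norm (F (z + (1 / real (Suc n)) *\<^sub>R v) - F z - (1 / real (Suc n)) *\<^sub>R F' z) / norm (1 / real (Suc n))
        = norm (D n z - F' z)" for n
    proof -
      have "D n z - F' z = of_real (real (Suc n)) *
          (F (z + (1 / real (Suc n)) *\<^sub>R v) - F z - (1 / real (Suc n)) *\<^sub>R F' z)"
        by (simp add: D_def scaleR_conv_of_real right_diff_distrib del: of_nat_Suc)
      thus ?thesis by (simp only: norm_mult norm_of_real norm_divide) simp
    qed
    with lim have "(\<lambda>n. norm (D n z - F' z)) \<longlonglongrightarrow> 0" by simp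
    thus ?thesis by (simp only: tendsto_norm_zero_iff LIM_zero_iff)
  qed
  have cont_shift: "continuous_on UNIV (\<lambda>z. F (z + w))" for w
    by (rule continuous_on_compose2[OF cont(1)]) (auto intro!: continuous_intros)
  have "(LINT z|lebesgue. D n z) = 0" for n
  proof -
    have "integrable lebesgue (\<lambda>z. F (z + (1 / real (Suc n)) *\<^sub>R v))"
      by (rule lebesgue_integral_translation(2)[OF cont(1) int])
    thus ?thesis
      unfolding D_def using int by (simp add: lebesgue_integral_translation(1)[OF cont(1)] del: of_nat_Suc)
  qed
  moreover have "(\<lambda>n. LINT z|lebesgue. D n z) \<longlonglongrightarrow> (LINT z|lebesgue. F' z)"
  proof (rule Bochner_Integration.integral_dominated_convergence)
    show "integrable lebesgue W"
      unfolding W_def by (intro integrable_mult_right integrable_gaussian) (use b in simp)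
    show "D n \<in> borel_measurable lebesgue" for n
      unfolding D_def[abs_def]
      by (intro borel_measurable_lebesgue_continuous continuous_on_mult continuous_on_diff
          continuous_on_const cont_shift cont)
  qed (use D_lim D_bound cont borel_measurable_lebesgue_continuous in auto)
  ultimately show ?thesis by (simp add: LIMSEQ_const_iff)
qed

section \<open>Orthogonality of the complex Hermite functions\<close>

text \<open>The derivative in the real direction \<open>v\<close> of the \<open>j\<close>-th coordinate is \<open>P v + Q cnj v\<close>; the directions
  \<open>1\<close> and \<open>i\<close> separate the two integrals.\<close>

lemma integral_wirtinger_zero:
  fixes f :: "complex ^ 'n::finite \<Rightarrow> complex"
  assumes wirt: "has_wirtinger j (\<lambda>z. f z * gauss c z) (\<lambda>z. P z * gauss c z) (\<lambda>z. Q z * gauss c z)"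
    and sub: "subgaussian f" "subgaussian P" "subgaussian Q" and c: "Re c > 0"
  shows "(LINT z|lebesgue. P z * gauss c z) = 0" "(LINT z|lebesgue. Q z * gauss c z) = 0"
proof -
  let ?p = "LINT z|lebesgue. P z * gauss c z" and ?q = "LINT z|lebesgue. Q z * gauss c z"
  have dir: "?p * v + ?q * cnj v = 0" for v
  proof -
    let ?R = "\<lambda>z. P z * v + Q z * cnj v"
    have R: "subgaussian ?R"
      by (intro subgaussian_add subgaussian_mult subgaussian_const sub)
    obtain C where C: "\<And>z. cmod (?R z * gauss c z) \<le> C * exp (- (Re c / 2 * (norm z)\<^sup>2))"
      using subgaussian_gauss_bound[OF R c] by blast
    have "(LINT z|lebesgue. ?R z * gauss c z) = 0"
    proof (rule integral_directional_derivative_zero[where F = "\<lambda>z. f z * gauss c z" and v = "axis j v"])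
      show "((\<lambda>t. f (z + t *\<^sub>R axis j v) * gauss c (z + t *\<^sub>R axis j v)) has_vector_derivative
              ?R z * gauss c z) (at 0)" for z
        using has_wirtinger_directional[OF wirt, of z v] by (simp add: algebra_simps)
      show "Re c / 2 > 0" using c by simp
    qed (use C in \<open>auto intro: continuous_on_subgaussian_gauss integrable_subgaussian_gauss sub R c\<close>)
    also have "(LINT z|lebesgue. ?R z * gauss c z)
        = (LINT z|lebesgue. (P z * gauss c z) * v + (Q z * gauss c z) * cnj v)"
      by (rule Bochner_Integration.integral_cong) (auto simp: algebra_simps)
    also have "\<dots> = ?p * v + ?q * cnj v"
      by (simp add: integrable_subgaussian_gauss[OF sub(2) c] integrable_subgaussian_gauss[OF sub(3) c])
    finally show ?thesis .
  qed
  from dir[of 1] have "?p + ?q = 0" by simp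
  moreover from dir[of \<i>] have "\<i> * (?p - ?q) = 0" by (simp add: algebra_simps)
  ultimately show "?p = 0" "?q = 0" by (auto simp: add_eq_0_iff)
qed

text \<open>The inner product of \<open>f\<close> and \<open>g\<close> after multiplication of both with \<open>exp (- (\<mu> + i \<nu>) |z|\<^sup>2 / 2)\<close>,
  whatever \<open>\<nu>\<close> is.\<close>

definition gauss_inner :: "real \<Rightarrow> (complex ^ 'n::finite \<Rightarrow> complex) \<Rightarrow> (complex ^ 'n \<Rightarrow> complex) \<Rightarrow> complex" where
  "gauss_inner \<mu> f g = (LINT z|lebesgue. (f z * cnj (g z)) * gauss (of_real \<mu>) z)"

lemma L2_inner_gauss:
  assumes "c + cnj c = of_real \<mu>"
  shows "L2_inner (\<lambda>z. f z * gauss c z) (\<lambda>z. g z * gauss c z) = gauss_inner \<mu> f g"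
proof -
  have "(f z * gauss c z) * cnj (g z * gauss c z) = (f z * cnj (g z)) * gauss (of_real \<mu>) z" for z
  proof -
    have "(f z * gauss c z) * cnj (g z * gauss c z) = (f z * cnj (g z)) * (gauss c z * gauss (cnj c) z)"
      by (simp add: cnj_gauss mult_ac)
    thus ?thesis by (simp only: gauss_mult assms)
  qed
  thus ?thesis unfolding L2_inner_def gauss_inner_def by (simp only:)
qed

lemma gauss_inner_cnj: "gauss_inner \<mu> f g = cnj (gauss_inner \<mu> g f)"
proof -
  have "cnj (gauss_inner \<mu> g f) = (LINT z|lebesgue. cnj ((g z * cnj (f z)) * gauss (of_real \<mu>) z))"
    unfolding gauss_inner_def by (rule Bochner_Integration.integral_cnj[symmetric])
  also have "\<dots> = gauss_inner \<mu> f g"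
    unfolding gauss_inner_def by (rule Bochner_Integration.integral_cong) (auto simp: cnj_gauss mult_ac)
  finally show ?thesis ..
qed

lemma gauss_inner_scale_diff:
  assumes "subgaussian f" "subgaussian g" "subgaussian u" "subgaussian v" "\<mu> > 0"
    and "(LINT z|lebesgue. (a * (f z * cnj (g z)) - b * (u z * cnj (v z))) * gauss (of_real \<mu>) z) = 0"
  shows "a * gauss_inner \<mu> f g = b * gauss_inner \<mu> u v"
proof -
  have i: "integrable lebesgue (\<lambda>z. (f z * cnj (g z)) * gauss (of_real \<mu>) z)"
    "integrable lebesgue (\<lambda>z. (u z * cnj (v z)) * gauss (of_real \<mu>) z)"
    using assms by (auto intro!: integrable_subgaussian_gauss subgaussian_mult subgaussian_cnj)
  have "(LINT z|lebesgue. (a * (f z * cnj (g z)) - b * (u z * cnj (v z))) * gauss (of_real \<mu>) z)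
     = (LINT z|lebesgue. a * ((f z * cnj (g z)) * gauss (of_real \<mu>) z) - b * ((u z * cnj (v z)) * gauss (of_real \<mu>) z))"
    by (rule Bochner_Integration.integral_cong) (auto simp: algebra_simps)
  also have "\<dots> = a * gauss_inner \<mu> f g - b * gauss_inner \<mu> u v"
    unfolding gauss_inner_def using i by simp
  finally show ?thesis using assms(6) by simp
qed

lemma has_wirtinger_cong:
  "has_wirtinger j f p q \<Longrightarrow> (\<And>z. p z = p' z) \<Longrightarrow> (\<And>z. q z = q' z) \<Longrightarrow> has_wirtinger j f p' q'"
  by (simp add: has_wirtinger_def)

text \<open>The integrals of the two Wirtinger derivatives of \<open>H\<^sub>r\<^sub>,\<^sub>s cnj H\<^sub>r\<^sub>'\<^sub>,\<^sub>s\<^sub>' exp (- \<mu> |z|\<^sup>2)\<close> vanish.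
  In them, the derivatives of \<open>H\<^sub>r\<^sub>,\<^sub>s\<close> and of the Gaussian combine to a raised index, and the derivative
  of \<open>cnj H\<^sub>r\<^sub>'\<^sub>,\<^sub>s\<^sub>'\<close> is a lowered one.\<close>

lemma gauss_inner_raise:
  assumes "\<mu> > 0"
  shows gauss_inner_raise_left:
    "gauss_inner \<mu> (ito_prod \<mu> (r(j := Suc (r j))) s) (ito_prod \<mu> r' s')
     = of_real \<mu> * of_nat (r' j) * gauss_inner \<mu> (ito_prod \<mu> r s) (ito_prod \<mu> (r'(j := r' j - 1)) s')"
    and gauss_inner_raise_right:
    "of_real \<mu> * gauss_inner \<mu> (ito_prod \<mu> r (s(j := Suc (s j)))) (ito_prod \<mu> r' s')
     = of_nat (s' j) * gauss_inner \<mu> (ito_prod \<mu> r s) (ito_prod \<mu> r' (s'(j := s' j - 1)))"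
proof -
  let ?H = "ito_prod \<mu>"
  let ?G = "gauss (of_real \<mu>) :: complex ^ 'a \<Rightarrow> complex"
  let ?P = "\<lambda>z. (of_real \<mu> * of_nat (r' j)) * (?H r s z * cnj (?H (r'(j := r' j - 1)) s' z))
                 - 1 * (?H (r(j := Suc (r j))) s z * cnj (?H r' s' z))"
  let ?Q = "\<lambda>z. of_nat (s' j) * (?H r s z * cnj (?H r' (s'(j := s' j - 1)) z))
                 - of_real \<mu> * (?H r (s(j := Suc (s j))) z * cnj (?H r' s' z))"
  have sub: "subgaussian (\<lambda>z. ?H r s z * cnj (?H r' s' z))" "subgaussian ?P" "subgaussian ?Q"
    by (intro subgaussian_diff subgaussian_mult subgaussian_const subgaussian_cnj subgaussian_ito_prod)+
  have wirt: "has_wirtinger j (\<lambda>z. (?H r s z * cnj (?H r' s' z)) * ?G z) (\<lambda>z. ?P z * ?G z) (\<lambda>z. ?Q z * ?G z)"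
    by (rule has_wirtinger_cong[OF has_wirtinger_mult[OF has_wirtinger_mult[OF has_wirtinger_ito_prod
            has_wirtinger_cnj[OF has_wirtinger_ito_prod]] has_wirtinger_gauss]])
      (simp_all only: ito_prod_raise_left ito_prod_raise_right,
       simp_all add: algebra_simps del: fun_upd_apply)
  note zero = integral_wirtinger_zero[OF wirt sub]
  note diff = gauss_inner_scale_diff[OF subgaussian_ito_prod subgaussian_ito_prod
      subgaussian_ito_prod subgaussian_ito_prod assms]
  show "gauss_inner \<mu> (?H (r(j := Suc (r j))) s) (?H r' s')
     = of_real \<mu> * of_nat (r' j) * gauss_inner \<mu> (?H r s) (?H (r'(j := r' j - 1)) s')"
    using diff[OF zero(1)] assms by simp
  show "of_real \<mu> * gauss_inner \<mu> (?H r (s(j := Suc (s j)))) (?H r' s')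
     = of_nat (s' j) * gauss_inner \<mu> (?H r s) (?H r' (s'(j := s' j - 1)))"
    using diff[OF zero(2)] assms by simp
qed

lemma gauss_inner_one:
  assumes "\<mu> > 0"
  shows "gauss_inner \<mu> (\<lambda>_::complex ^ 'n::finite. 1) (\<lambda>_. 1) \<noteq> 0"
proof
  assume z: "gauss_inner \<mu> (\<lambda>_::complex ^ 'n. 1) (\<lambda>_. 1) = 0"
  let ?e = "\<lambda>z::complex ^ 'n. exp (- (\<mu> * (norm z)\<^sup>2))"
  have "gauss (of_real \<mu>) z = of_real (?e z)" for z
    by (simp add: gauss_def exp_of_real[symmetric])
  with z have "complex_of_real (LINT z|lebesgue. ?e z) = 0"
    by (simp add: gauss_inner_def del: exp_of_real of_real_exp)
  hence "(LINT z|lebesgue. ?e z) = 0" by simp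
  moreover have "integrable lebesgue ?e" by (rule integrable_gaussian[OF assms])
  ultimately have "AE z in lebesgue. ?e z = 0"
    by (subst (asm) integral_nonneg_eq_0_iff_AE) auto
  hence "AE z in (lebesgue :: (complex ^ 'n) measure). False" by simp
  hence "emeasure (lebesgue :: (complex ^ 'n) measure) UNIV = 0"
    unfolding eventually_False ae_filter_eq_bot_iff by simp
  thus False by (simp add: emeasure_lborel_UNIV)
qed

text \<open>As long as \<open>r\<close> or \<open>s\<close> is nonzero, one entry of it is traded for the same entry of \<open>r'\<close> or \<open>s'\<close>. This
  preserves whether the two pairs agree, and gives \<open>0\<close> if that entry is already exhausted on the
  right. Once \<open>r = s = 0\<close>, the same argument with the two sides exchanged reduces everything to the
  integral of the Gaussian.\<close>

lemma gauss_inner_orthogonal: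
  assumes \<mu>: "\<mu> > 0"
  shows "gauss_inner \<mu> (ito_prod \<mu> r s) (ito_prod \<mu> r' s') = 0 \<longleftrightarrow> (r, s) \<noteq> (r', s')"
proof (induction "sum r UNIV + sum s UNIV" arbitrary: r s r' s' rule: less_induct)
  case less
  have upd_eq: "r = r' \<longleftrightarrow> r(j := r j - 1) = r'(j := r' j - 1)" if "r j > 0" "r' j > 0"
    for r r' :: "'a \<Rightarrow> nat" and j
  proof
    assume eq: "r(j := r j - 1) = r'(j := r' j - 1)"
    show "r = r'"
    proof
      fix i show "r i = r' i"
        using fun_cong[OF eq, of i] that by (cases "i = j") auto
    qed
  qed simp
  have sum_upd: "sum (r(j := r j - 1)) UNIV < sum r UNIV" if "r j > 0" for r :: "'a \<Rightarrow> nat" and j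
    by (rule sum_strict_mono_ex1) (use that in auto)
  have low_r: "?case" if j: "r j > 0" for j
  proof -
    have eq: "gauss_inner \<mu> (ito_prod \<mu> r s) (ito_prod \<mu> r' s')
       = of_real \<mu> * of_nat (r' j) *
         gauss_inner \<mu> (ito_prod \<mu> (r(j := r j - 1)) s) (ito_prod \<mu> (r'(j := r' j - 1)) s')"
      using gauss_inner_raise_left[OF \<mu>, of "r(j := r j - 1)" j s r' s'] j by simp
    show ?thesis
    proof (cases "r' j > 0")
      case True
      with less[of "r(j := r j - 1)" s "r'(j := r' j - 1)" s'] sum_upd[where r = r and j = j, OF j]
        upd_eq[where r = r and r' = r' and j = j, OF j True] \<mu>
      show ?thesis unfolding eq by auto
    next
      case False
      with j show ?thesis unfolding eq by auto
    qed
  qed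
  have low_s: "?case" if j: "s j > 0" for j
  proof -
    have eq: "of_real \<mu> * gauss_inner \<mu> (ito_prod \<mu> r s) (ito_prod \<mu> r' s')
       = of_nat (s' j) *
         gauss_inner \<mu> (ito_prod \<mu> r (s(j := s j - 1))) (ito_prod \<mu> r' (s'(j := s' j - 1)))"
      using gauss_inner_raise_right[OF \<mu>, of r "s(j := s j - 1)" j r' s'] j by simp
    have "gauss_inner \<mu> (ito_prod \<mu> r s) (ito_prod \<mu> r' s') = 0 \<longleftrightarrow>
        of_real \<mu> * gauss_inner \<mu> (ito_prod \<mu> r s) (ito_prod \<mu> r' s') = 0" using \<mu> by simp
    also have "\<dots> \<longleftrightarrow> (r, s) \<noteq> (r', s')"
    proof (cases "s' j > 0")
      case True
      with less[of r "s(j := s j - 1)" r' "s'(j := s' j - 1)"] sum_upd[where r = s and j = j, OF j]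
        upd_eq[where r = s and r' = s' and j = j, OF j True]
      show ?thesis unfolding eq by auto
    next
      case False
      with j show ?thesis unfolding eq by auto
    qed
    finally show ?thesis .
  qed
  show ?case
  proof (cases "\<exists>j. r j > 0 \<or> s j > 0")
    case True
    with low_r low_s show ?thesis by blast
  next
    case False
    hence rs: "r = (\<lambda>_. 0)" "s = (\<lambda>_. 0)" by (auto simp: fun_eq_iff)
    have swap: "gauss_inner \<mu> (ito_prod \<mu> r s) (ito_prod \<mu> r' s') = 0" 
      if "gauss_inner \<mu> (ito_prod \<mu> r' s') (ito_prod \<mu> r s) = 0"
      using that by (subst gauss_inner_cnj) simp
    consider j where "r' j > 0" | j where "s' j > 0" | "r' = (\<lambda>_. 0)" "s' = (\<lambda>_. 0)"
      by (metis gr_zeroI ext)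
    thus ?thesis
    proof cases
      case (1 j)
      hence "gauss_inner \<mu> (ito_prod \<mu> r' s') (ito_prod \<mu> r s) = 0"
        using gauss_inner_raise_left[OF \<mu>, of "r'(j := r' j - 1)" j s' r s] by (simp add: rs)
      from swap[OF this] 1 show ?thesis by (auto simp: rs)
    next
      case (2 j)
      hence "gauss_inner \<mu> (ito_prod \<mu> r' s') (ito_prod \<mu> r s) = 0"
        using gauss_inner_raise_right[OF \<mu>, of r' "s'(j := s' j - 1)" j r s] \<mu> by (simp add: rs)
      from swap[OF this] 2 show ?thesis by (auto simp: rs)
    next
      case 3
      have "ito_prod \<mu> (\<lambda>_::'a. 0) (\<lambda>_. 0) = (\<lambda>_. 1)" by (simp add: ito_prod_def fun_eq_iff)
      with 3 show ?thesis using gauss_inner_one[OF \<mu>] by (simp add: rs)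
    qed
  qed
qed

section \<open>Density of weighted trigonometric polynomials\<close>

lemma complex_span_sum:
  "(\<And>i. i \<in> I \<Longrightarrow> f i \<in> complex_span S) \<Longrightarrow> (\<lambda>x. \<Sum>i\<in>I. f i x) \<in> complex_span S"
  by (induction I rule: infinite_finite_induct) (auto intro: complex_span_zero complex_span_add)

text \<open>Their linear combinations are the trigonometric polynomials, with arbitrary real frequencies.\<close>

definition characters :: "('a::euclidean_space \<Rightarrow> complex) set" where
  "characters = {\<lambda>x. exp (\<i> * of_real (\<xi> \<bullet> x)) | \<xi>. True}"

lemma trig_poly_mult:
  assumes "f \<in> complex_span characters" "g \<in> complex_span characters"
  shows "(\<lambda>x. f x * g x) \<in> complex_span characters"
  using assms(1)
proof (induction rule: complex_span_induct)
  case zero show ?case by (simp add: complex_span_zero)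
next
  case (add f f')
  from complex_span_add[OF add] show ?case by (simp add: algebra_simps)
next
  case (scale c f)
  from complex_span_scale[OF scale, of c] show ?case by (simp add: algebra_simps)
next
  case (base f)
  then obtain \<xi> where f: "f = (\<lambda>x. exp (\<i> * of_real (\<xi> \<bullet> x)))" by (auto simp: characters_def)
  show ?case using assms(2)
  proof (induction rule: complex_span_induct)
    case zero show ?case by (simp add: complex_span_zero)
  next
    case (add g g')
    from complex_span_add[OF add] show ?case by (simp add: algebra_simps)
  next
    case (scale c g)
    from complex_span_scale[OF scale, of c] show ?case by (simp add: algebra_simps)
  next
    case (base g)
    then obtain \<eta> where g: "g = (\<lambda>x. exp (\<i> * of_real (\<eta> \<bullet> x)))" by (auto simp: characters_def)
    have "(\<lambda>x. f x * g x) = (\<lambda>x. exp (\<i> * of_real ((\<xi> + \<eta>) \<bullet> x)))"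
      by (simp add: f g inner_add_left ring_distribs exp_add)
    thus ?case by (intro complex_span_base) (auto simp: characters_def)
  qed
qed

lemma trig_poly_const: "(\<lambda>x. c) \<in> complex_span characters"
proof -
  have "(\<lambda>x::'a. 1::complex) \<in> characters" unfolding characters_def
    by (intro CollectI exI[of _ 0]) auto
  from complex_span_scale[OF complex_span_base[OF this], of c] show ?thesis by simp
qed

lemma trig_poly_sin: "(\<lambda>x. of_real (sin (\<xi> \<bullet> x))) \<in> complex_span characters"
proof -
  have m: "(\<lambda>x. exp (\<i> * of_real (\<eta> \<bullet> x))) \<in> complex_span characters" for \<eta> :: 'a
    by (rule complex_span_base) (auto simp: characters_def)
  have "of_real (sin (\<xi> \<bullet> x)) = - \<i> / 2 * exp (\<i> * of_real (\<xi> \<bullet> x)) + \<i> / 2 * exp (\<i> * of_real ((- \<xi>) \<bullet> x))" for x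
    by (simp add: exp_Euler exp_minus_Euler sin_of_real algebra_simps)
  with complex_span_add[OF complex_span_scale[OF m[of \<xi>], of "- \<i> / 2"] complex_span_scale[OF m[of "- \<xi>"], of "\<i> / 2"]]
  show ?thesis by simp
qed

text \<open>For \<open>R > 0\<close> a periodic map to the cube between \<open>- One\<close> and \<open>One\<close>, injective on the cube of half side
  length \<open>R \<pi> / 2\<close> around the origin.\<close>

definition sine_box :: "real \<Rightarrow> 'a::euclidean_space \<Rightarrow> 'a" where
  "sine_box R x = (\<Sum>b\<in>Basis. sin (x \<bullet> b / R) *\<^sub>R b)"

lemma trig_poly_real_polynomial_sine_box:
  "real_polynomial_function p \<Longrightarrow> (\<lambda>x. of_real (p (sine_box R x))) \<in> complex_span characters"
proof (induction rule: real_polynomial_function.induct)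
  case (linear h)
  have "of_real (h (sine_box R x)) = (\<Sum>b\<in>Basis. of_real (h b) * complex_of_real (sin ((b /\<^sub>R R) \<bullet> x)))" for x
    using bounded_linear.linear[OF linear]
    by (simp add: sine_box_def linear_sum linear_scale inner_commute divide_inverse mult.commute)
  moreover have "(\<lambda>x. \<Sum>b\<in>Basis. of_real (h b) * complex_of_real (sin ((b /\<^sub>R R) \<bullet> x))) \<in> complex_span characters"
    by (intro complex_span_sum complex_span_scale trig_poly_sin)
  ultimately show ?case by simp
next
  case (const c) show ?case by (rule trig_poly_const)
next
  case (add p q) from complex_span_add[OF add.IH] show ?case by simp
next
  case (mult p q) from trig_poly_mult[OF mult.IH] show ?case by simp
qed

lemma trig_poly_polynomial_sine_box:
  fixes q :: "'a::euclidean_space \<Rightarrow> complex"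
  assumes "polynomial_function q"
  shows "(\<lambda>x. q (sine_box R x)) \<in> complex_span characters"
proof -
  have "real_polynomial_function (Re \<circ> q)" "real_polynomial_function (Im \<circ> q)"
    using assms bounded_linear_Re bounded_linear_Im by (auto simp: polynomial_function_def)
  from this[THEN trig_poly_real_polynomial_sine_box[of _ R]]
  have "(\<lambda>x. of_real (Re (q (sine_box R x))) + \<i> * of_real (Im (q (sine_box R x)))) \<in> complex_span characters"
    by (intro complex_span_add complex_span_scale) simp_all
  thus ?thesis by (simp flip: complex_eq)
qed

text \<open>A polynomial \<open>q\<close> approximates \<open>F \<circ> R arcsin\<close> on the cube, and \<open>q \<circ> sine_box R\<close> is the required function:
  near the origin the arcsine undoes the sine, and everywhere else \<open>sine_box R\<close> still takes its values in
  the cube, where \<open>q\<close> is bounded.\<close>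

lemma trig_poly_approximation:
  fixes F :: "'a::euclidean_space \<Rightarrow> complex"
  assumes F: "continuous_on UNIV F" and B: "\<And>x. cmod (F x) \<le> B" and R: "R \<ge> 1"
  shows "\<exists>T\<in>complex_span characters.
    (\<forall>x. cmod (T x) \<le> B + 1) \<and> (\<forall>x. norm x \<le> R \<longrightarrow> cmod (F x - T x) \<le> 1 / R)"
proof -
  define K where "K = cbox (- One) (One :: 'a)"
  define a where "a u = (\<Sum>b\<in>Basis. (R * arcsin (u \<bullet> b)) *\<^sub>R b)" for u :: 'a
  have Kb: "-1 \<le> u \<bullet> b" "u \<bullet> b \<le> 1" if "u \<in> K" "b \<in> Basis" for u b
    using that by (auto simp: K_def mem_box)
  have cont_a: "continuous_on K a"
    unfolding a_def by (intro continuous_intros ballI conjI) (use Kb in auto)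
  have cont: "continuous_on K (F \<circ> a)"
    by (intro continuous_on_compose cont_a continuous_on_subset[OF F]) auto
  have "compact K" by (simp add: K_def compact_cbox)
  moreover have "1 / R > 0" using R by simp
  ultimately have "\<exists>q. polynomial_function q \<and> (\<forall>u\<in>K. cmod ((F \<circ> a) u - q u) < 1 / R)"
    by (intro Stone_Weierstrass_polynomial_function cont)
  then obtain q where "polynomial_function q \<and> (\<forall>u\<in>K. cmod ((F \<circ> a) u - q u) < 1 / R)" ..
  hence q: "polynomial_function q" "\<And>u. u \<in> K \<Longrightarrow> cmod ((F \<circ> a) u - q u) < 1 / R" by blast+
  have inner: "sine_box R x \<bullet> b = sin (x \<bullet> b / R)" if "b \<in> Basis" for x b
    using that unfolding sine_box_def by (simp add: inner_sum_left_Basis)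
  have K: "sine_box R x \<in> K" for x by (simp add: K_def mem_box inner)
  have "cmod (q (sine_box R x)) \<le> B + 1" for x
  proof -
    have "1 / R \<le> 1" using R by simp
    with q(2)[OF K[of x]] B[of "a (sine_box R x)"]
      norm_triangle_ineq2[of "q (sine_box R x)" "F (a (sine_box R x))"]
    show ?thesis by (simp add: norm_minus_commute)
  qed
  moreover have "cmod (F x - q (sine_box R x)) \<le> 1 / R" if x: "norm x \<le> R" for x
  proof -
    have "R * arcsin (sine_box R x \<bullet> b) = x \<bullet> b" if b: "b \<in> Basis" for b
    proof -
      have "\<bar>x \<bullet> b\<bar> \<le> R" using Basis_le_norm[OF b, of x] x by simp
      hence "\<bar>x \<bullet> b / R\<bar> \<le> 1" using R by simp
      hence "\<bar>x \<bullet> b / R\<bar> \<le> pi / 2" using pi_ge_two by linarith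
      hence "- (pi / 2) \<le> x \<bullet> b / R" "x \<bullet> b / R \<le> pi / 2" by linarith+
      hence "arcsin (sin (x \<bullet> b / R)) = x \<bullet> b / R" by (rule arcsin_sin)
      thus ?thesis using R by (simp add: inner[OF b])
    qed
    hence "a (sine_box R x) = x" unfolding a_def by (simp add: euclidean_representation)
    with q(2)[OF K[of x]] show ?thesis by simp
  qed
  ultimately show ?thesis using trig_poly_polynomial_sine_box[OF q(1), of R]
    by (intro bexI[of _ "\<lambda>x. q (sine_box R x)"]) auto
qed

context
  fixes A :: "('a::euclidean_space \<Rightarrow> complex) set" and g :: "'a \<Rightarrow> complex"
  assumes A: "L2_closed_subspace A" and g: "g \<in> L2_space" "\<And>x. g x \<noteq> 0"
    and char: "\<And>\<xi>. (\<lambda>x. exp (\<i> * of_real (\<xi> \<bullet> x)) * g x) \<in> A"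
begin

lemma trig_poly_weighted_mem:
  assumes "T \<in> complex_span characters"
  shows "(\<lambda>x. T x * g x) \<in> A"
  using assms
proof (induction rule: complex_span_induct)
  case zero show ?case using L2_closed_subspaceD(2)[OF A] by simp
next
  case (add f h)
  from L2_closed_subspaceD(3)[OF A add] show ?case by (simp add: algebra_simps)
next
  case (scale c f)
  from L2_closed_subspaceD(4)[OF A scale, of c] show ?case by (simp add: algebra_simps)
next
  case (base f) thus ?case using char by (auto simp: characters_def)
qed

lemma weight_integrable: "integrable lebesgue (\<lambda>x. (B * cmod (g x))\<^sup>2)"
  using L2_integrable[OF g(1)] by (simp add: power_mult_distrib)

text \<open>The global bound \<open>B + 1\<close> on the approximants is what makes dominated convergence applicable.\<close>

lemma bounded_continuous_weighted_mem:
  assumes F: "continuous_on UNIV F" and B: "\<And>x. cmod (F x) \<le> B"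
  shows "(\<lambda>x. F x * g x) \<in> A"
proof -
  have "\<exists>T\<in>complex_span characters. (\<forall>x. cmod (T x) \<le> B + 1) \<and>
      (\<forall>x. norm x \<le> real (Suc n) \<longrightarrow> cmod (F x - T x) \<le> 1 / real (Suc n))" for n
    by (rule trig_poly_approximation[OF F B]) simp
  then obtain T where T: "\<And>n. T n \<in> complex_span characters" "\<And>n x. cmod (T n x) \<le> B + 1"
    "\<And>n x. norm x \<le> real (Suc n) \<Longrightarrow> cmod (F x - T n x) \<le> 1 / real (Suc n)"
    by metis
  show ?thesis
  proof (rule L2_closed_subspace_dominated[OF A])
    show "(\<lambda>x. T n x * g x) \<in> A" for n by (rule trig_poly_weighted_mem[OF T(1)])
    show "(\<lambda>x. F x * g x) \<in> borel_measurable lebesgue"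
      by (intro borel_measurable_times borel_measurable_lebesgue_continuous F L2_measurable g(1))
    show "integrable lebesgue (\<lambda>x. ((B + 1) * cmod (g x))\<^sup>2)" by (rule weight_integrable)
    have "(\<lambda>n. T n x) \<longlonglongrightarrow> F x" for x
    proof -
      have "(\<lambda>n. T n x - F x) \<longlonglongrightarrow> 0"
      proof (rule Lim_null_comparison)
        show "(\<lambda>n. 1 / real (Suc n)) \<longlonglongrightarrow> 0" by (rule LIMSEQ_Suc[OF lim_1_over_n])
        show "\<forall>\<^sub>F n in sequentially. norm (T n x - F x) \<le> 1 / real (Suc n)"
          using eventually_ge_at_top[of "nat \<lceil>norm x\<rceil>"]
        proof eventually_elim
          case (elim n)
          hence "norm x \<le> real (Suc n)" by linarith
          from T(3)[OF this] show ?case by (simp add: norm_minus_commute)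
        qed
      qed
      thus ?thesis by (simp add: LIM_zero_iff)
    qed
    thus "AE x in lebesgue. (\<lambda>n. T n x * g x) \<longlonglongrightarrow> F x * g x"
      by (intro always_eventually allI tendsto_mult tendsto_const)
    show "AE x in lebesgue. cmod (T n x * g x) \<le> (B + 1) * cmod (g x)" for n
      using T(2) by (intro always_eventually allI) (simp add: norm_mult mult_right_mono)
  qed
qed

text \<open>A measurable function is an almost everywhere limit of continuous ones; composing these with the
  projection to the disc of radius \<open>B\<close> keeps them bounded and does not change the limit.\<close>

lemma bounded_measurable_weighted_mem:
  assumes F: "F \<in> borel_measurable lebesgue" and B: "\<And>x. cmod (F x) \<le> B"
  shows "(\<lambda>x. F x * g x) \<in> A"
proof -
  have B0: "B \<ge> 0" using order_trans[OF norm_ge_zero B] .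
  have "F measurable_on UNIV" using F by (simp add: lebesgue_measurable_imp_measurable_on)
  then obtain N G where N: "negligible N" and G: "\<And>n. continuous_on UNIV (G n)"
    "\<And>x. x \<notin> N \<Longrightarrow> (\<lambda>n. G n x) \<longlonglongrightarrow> F x"
    by (auto simp: measurable_on_def)
  define clip where "clip = closest_point (cball (0::complex) B)"
  have clip_cont: "continuous_on UNIV clip"
    unfolding clip_def using B0 by (intro continuous_on_closest_point) auto
  have clip_le: "cmod (clip w) \<le> B" for w
    using closest_point_in_set[of "cball (0::complex) B" w] B0 by (simp add: clip_def)
  have clip_id: "clip w = w" if "cmod w \<le> B" for w
    unfolding clip_def by (rule closest_point_self) (use that in simp)
  show ?thesis
  proof (rule L2_closed_subspace_dominated[OF A])
    show "(\<lambda>x. clip (G n x) * g x) \<in> A" for n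
      by (rule bounded_continuous_weighted_mem[where B = B,
            OF continuous_on_compose2[OF clip_cont G(1)] clip_le]) simp
    show "(\<lambda>x. F x * g x) \<in> borel_measurable lebesgue"
      by (intro borel_measurable_times F L2_measurable g(1))
    show "integrable lebesgue (\<lambda>x. (B * cmod (g x))\<^sup>2)" by (rule weight_integrable)
    have "(\<lambda>n. clip (G n x)) \<longlonglongrightarrow> F x" if "x \<notin> N" for x
      using continuous_on_tendsto_compose[OF clip_cont G(2)[OF that]] clip_id[OF B] by simp
    hence lim: "(\<lambda>n. clip (G n x) * g x) \<longlonglongrightarrow> F x * g x" if "x \<notin> N" for x
      using that by (intro tendsto_mult tendsto_const)
    have "AE x in lebesgue. x \<notin> N"
      using N by (intro AE_not_in) (simp add: negligible_iff_null_sets)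
    thus "AE x in lebesgue. (\<lambda>n. clip (G n x) * g x) \<longlonglongrightarrow> F x * g x"
      by (rule eventually_mono) (rule lim)
    show "AE x in lebesgue. cmod (clip (G n x) * g x) \<le> B * cmod (g x)" for n
      using clip_le by (intro always_eventually allI) (simp add: norm_mult mult_right_mono)
  qed
qed

text \<open>The quotient \<open>f / g\<close>, cut off where its modulus exceeds \<open>n\<close>, is bounded.\<close>

lemma L2_space_subset_if_weighted_characters: "L2_space \<subseteq> A"
proof
  fix f :: "'a \<Rightarrow> complex" assume f: "f \<in> L2_space"
  have m: "(\<lambda>x. f x / g x) \<in> borel_measurable lebesgue"
    by (intro borel_measurable_divide L2_measurable f g(1))
  define F where "F n x = (if cmod (f x / g x) \<le> real n then f x / g x else 0)" for n x
  show "f \<in> A"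
  proof (rule L2_closed_subspace_dominated[OF A])
    show "(\<lambda>x. F n x * g x) \<in> A" for n
    proof (rule bounded_measurable_weighted_mem[where B = "real n"])
      show "F n \<in> borel_measurable lebesgue" unfolding F_def[abs_def] using m by measurable
    qed (simp add: F_def)
    show "f \<in> borel_measurable lebesgue" by (rule L2_measurable[OF f])
    show "integrable lebesgue (\<lambda>x. (cmod (f x))\<^sup>2)" by (rule L2_integrable[OF f])
    have "(\<lambda>n. F n x * g x) \<longlonglongrightarrow> f x" for x
    proof (rule tendsto_eventually)
      show "\<forall>\<^sub>F n in sequentially. F n x * g x = f x"
        using eventually_ge_at_top[of "nat \<lceil>cmod (f x / g x)\<rceil>"]
      proof eventually_elim
        case (elim n)
        hence "cmod (f x / g x) \<le> real n" by linarith
        thus ?case using g(2)[of x] by (simp add: F_def)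
      qed
    qed
    thus "AE x in lebesgue. (\<lambda>n. F n x * g x) \<longlonglongrightarrow> f x" by simp
    show "AE x in lebesgue. cmod (F n x * g x) \<le> cmod (f x)" for n
      by (intro always_eventually allI) (simp add: F_def g(2))
  qed
qed

end

text \<open>The partial sums of the exponential series are dominated by \<open>exp (|\<xi>| |x|)\<close>, which grows more slowly than the
  Gaussian decays.\<close>

lemma character_gauss_mem:
  fixes A :: "('a::euclidean_space \<Rightarrow> complex) set"
  assumes A: "L2_closed_subspace A" and c: "Re c > 0"
    and pow: "\<And>k. (\<lambda>x. of_real (\<xi> \<bullet> x) ^ k * gauss c x) \<in> A"
  shows "(\<lambda>x. exp (\<i> * of_real (\<xi> \<bullet> x)) * gauss c x) \<in> A"
proof (rule L2_closed_subspace_dominated[OF A])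
  define w where "w x = \<i> * complex_of_real (\<xi> \<bullet> x)" for x
  let ?S = "\<lambda>n x. (\<Sum>k<n. w x ^ k /\<^sub>R fact k) * gauss c x"
  have "?S n = (\<lambda>x. \<Sum>k<n. (\<i> ^ k / fact k) * (of_real (\<xi> \<bullet> x) ^ k * gauss c x))" for n
    unfolding sum_distrib_right w_def
    by (intro ext sum.cong) (simp_all add: power_mult_distrib scaleR_conv_of_real field_simps)
  moreover have "(\<lambda>x. \<Sum>k<n. (\<i> ^ k / fact k) * (of_real (\<xi> \<bullet> x) ^ k * gauss c x)) \<in> A" for n
    by (intro L2_closed_subspace_sum[OF A] L2_closed_subspaceD(4)[OF A] pow)
  ultimately show "?S n \<in> A" for n by simp
  show "(\<lambda>x. exp (\<i> * of_real (\<xi> \<bullet> x)) * gauss c x) \<in> borel_measurable lebesgue"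
    by (intro borel_measurable_lebesgue_continuous continuous_intros continuous_on_gauss)
  show "integrable lebesgue (\<lambda>x. (cmod (of_real (exp (norm \<xi> * norm x)) * gauss c x))\<^sup>2)"
    by (rule L2_integrable[OF L2_subgaussian_gauss[OF subgaussian_exp_norm c]])
  have "(\<lambda>n. ?S n x) \<longlonglongrightarrow> exp (\<i> * of_real (\<xi> \<bullet> x)) * gauss c x" for x
    using exp_converges[of "w x"] unfolding sums_def w_def[symmetric]
    by (intro tendsto_mult tendsto_const)
  thus "AE x in lebesgue. (\<lambda>n. ?S n x) \<longlonglongrightarrow> exp (\<i> * of_real (\<xi> \<bullet> x)) * gauss c x" by simp
  have "cmod (?S n x) \<le> cmod (of_real (exp (norm \<xi> * norm x)) * gauss c x)" for n x
  proof -
    have "cmod (\<Sum>k<n. w x ^ k /\<^sub>R fact k) \<le> (\<Sum>k<n. cmod (w x) ^ k /\<^sub>R fact k)"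
      by (rule order_trans[OF norm_sum]) (simp add: norm_power)
    also have "\<dots> \<le> exp (cmod (w x))"
      unfolding exp_def by (rule sum_le_suminf[OF summable_exp_generic]) auto
    also have "\<dots> \<le> exp (norm \<xi> * norm x)"
      using Cauchy_Schwarz_ineq2[of \<xi> x] by (simp add: w_def norm_mult)
    finally show ?thesis by (simp add: norm_mult mult_right_mono)
  qed
  thus "AE x in lebesgue. cmod (?S n x) \<le> cmod (of_real (exp (norm \<xi> * norm x)) * gauss c x)" for n
    by simp
qed

section \<open>The complete orthogonal system and its decomposition\<close>

definition ito_system :: "real \<Rightarrow> complex \<Rightarrow> (complex ^ 'n::finite \<Rightarrow> complex) set" where
  "ito_system \<mu> c = {\<lambda>z. ito_prod \<mu> r s z * gauss c z | r s. True}"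

lemma ito_system_mem: "(\<lambda>z. ito_prod \<mu> r s z * gauss c z) \<in> complex_span (ito_system \<mu> c)"
  by (rule complex_span_base) (auto simp: ito_system_def)

text \<open>Solving the two raising relations for \<open>z\<^sub>j H\<^sub>r\<^sub>,\<^sub>s\<close> and \<open>cnj z\<^sub>j H\<^sub>r\<^sub>,\<^sub>s\<close>. Together with the Gaussian itself,
  the span thus contains all polynomials in \<open>z\<close> and \<open>cnj z\<close> times the Gaussian.\<close>

lemma complex_span_ito_system_mult_coord:
  assumes "\<mu> \<noteq> 0" "f \<in> complex_span (ito_system \<mu> c)"
  shows "(\<lambda>z. z $ j * f z) \<in> complex_span (ito_system \<mu> c)"
    and "(\<lambda>z. cnj (z $ j) * f z) \<in> complex_span (ito_system \<mu> c)"
proof -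
  show "(\<lambda>z. z $ j * f z) \<in> complex_span (ito_system \<mu> c)"
    using assms(2)
  proof (induction rule: complex_span_induct)
    case zero show ?case by (simp add: complex_span_zero)
  next
    case (add f g) from complex_span_add[OF add] show ?case by (simp add: algebra_simps)
  next
    case (scale a f) from complex_span_scale[OF scale, of a] show ?case by (simp add: algebra_simps)
  next
    case (base f)
    then obtain r s where f: "f = (\<lambda>z. ito_prod \<mu> r s z * gauss c z)" by (auto simp: ito_system_def)
    have "(\<lambda>z. z $ j * f z) = (\<lambda>z. ito_prod \<mu> r (s(j := Suc (s j))) z * gauss c z
        + of_nat (r j) * (ito_prod \<mu> (r(j := r j - 1)) s z * gauss c z))"
      by (simp add: f ito_prod_raise_right algebra_simps del: fun_upd_apply)
    thus ?case by (simp only: complex_span_add complex_span_scale ito_system_mem)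
  qed
  show "(\<lambda>z. cnj (z $ j) * f z) \<in> complex_span (ito_system \<mu> c)"
    using assms(2)
  proof (induction rule: complex_span_induct)
    case zero show ?case by (simp add: complex_span_zero)
  next
    case (add f g) from complex_span_add[OF add] show ?case by (simp add: algebra_simps)
  next
    case (scale a f) from complex_span_scale[OF scale, of a] show ?case by (simp add: algebra_simps)
  next
    case (base f)
    then obtain r s where f: "f = (\<lambda>z. ito_prod \<mu> r s z * gauss c z)" by (auto simp: ito_system_def)
    have "(\<lambda>z. cnj (z $ j) * f z) = (\<lambda>z. 1 / of_real \<mu> * (ito_prod \<mu> (r(j := Suc (r j))) s z * gauss c z
        + of_nat (s j) * (ito_prod \<mu> r (s(j := s j - 1)) z * gauss c z)))"
      using assms(1) by (simp add: f ito_prod_raise_left field_simps del: fun_upd_apply)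
    thus ?case by (simp only: complex_span_add complex_span_scale ito_system_mem)
  qed
qed

lemma inner_vec_complex:
  "of_real (\<xi> \<bullet> z) = (\<Sum>j\<in>UNIV. cnj (\<xi> $ j) / 2 * z $ j + \<xi> $ j / 2 * cnj (z $ j))"
  for z :: "complex ^ 'n::finite"
  unfolding inner_vec_def of_real_sum
  by (rule sum.cong) (auto simp: complex_eq_iff inner_complex_def field_simps)

lemma complex_span_ito_system_inner_power:
  fixes \<xi> :: "complex ^ 'n::finite"
  assumes "\<mu> \<noteq> 0"
  shows "(\<lambda>z. of_real (\<xi> \<bullet> z) ^ k * gauss c z) \<in> complex_span (ito_system \<mu> c)"
proof (induction k)
  case 0
  have "ito_prod \<mu> (\<lambda>_::'n. 0) (\<lambda>_. 0) = (\<lambda>_. 1)" by (simp add: ito_prod_def fun_eq_iff)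
  with ito_system_mem[of \<mu> "\<lambda>_::'n. 0" "\<lambda>_. 0" c] show ?case by simp
next
  case (Suc k)
  let ?f = "\<lambda>z. of_real (\<xi> \<bullet> z) ^ k * gauss c z"
  have "(\<lambda>z. of_real (\<xi> \<bullet> z) ^ Suc k * gauss c z)
      = (\<lambda>z. (\<Sum>j\<in>UNIV. cnj (\<xi> $ j) / 2 * z $ j + \<xi> $ j / 2 * cnj (z $ j)) * ?f z)"
    by (simp add: inner_vec_complex mult_ac)
  also have "\<dots> = (\<lambda>z. \<Sum>j\<in>UNIV. cnj (\<xi> $ j) / 2 * (z $ j * ?f z) + \<xi> $ j / 2 * (cnj (z $ j) * ?f z))"
    by (simp only: sum_distrib_right distrib_right mult.assoc)
  also have "\<dots> \<in> complex_span (ito_system \<mu> c)"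
    by (intro complex_span_sum complex_span_add complex_span_scale
        complex_span_ito_system_mult_coord[OF assms Suc.IH])
  finally show ?case .
qed

lemma ito_system_subset_L2: "Re c > 0 \<Longrightarrow> ito_system \<mu> c \<subseteq> L2_space"
  by (auto simp: ito_system_def intro: L2_subgaussian_gauss subgaussian_ito_prod)

theorem ito_system_complete:
  fixes c :: complex
  assumes "\<mu> \<noteq> 0" and c: "Re c > 0"
  shows "L2_closed_span (ito_system \<mu> c :: (complex ^ 'n::finite \<Rightarrow> complex) set) = L2_space"
proof
  let ?A = "L2_closed_span (ito_system \<mu> c :: (complex ^ 'n \<Rightarrow> complex) set)"
  note S = ito_system_subset_L2[OF c, of \<mu>]
  note A = L2_closed_subspace_closed_span[OF S]
  have span: "complex_span (ito_system \<mu> c) \<subseteq> ?A"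
    unfolding L2_closed_span_def by (rule L2_closure_subset[OF complex_span_subset_L2[OF S]])
  show "L2_space \<subseteq> ?A"
  proof (rule L2_space_subset_if_weighted_characters[OF A])
    show "gauss c \<in> L2_space"
      using L2_subgaussian_gauss[OF subgaussian_const c, of 1] by simp
    show "gauss c z \<noteq> 0" for z :: "complex ^ 'n" by (simp add: gauss_def)
    show "(\<lambda>z. exp (\<i> * of_real (\<xi> \<bullet> z)) * gauss c z) \<in> ?A" for \<xi>
      by (intro character_gauss_mem[OF A c] subsetD[OF span]
          complex_span_ito_system_inner_power assms)
  qed
  show "?A \<subseteq> L2_space" by (auto simp: L2_closed_span_def L2_closure_def)
qed

text \<open>The vanishing beyond \<open>N\<close> lets the induction bring two sums to a common length.\<close>

lemma complex_span_decomposition: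
  assumes A: "\<And>l. L2_closed_subspace (A l)" and "S \<subseteq> (\<Union>l. A l)" and "p \<in> complex_span S"
  shows "\<exists>N q. (\<forall>l::nat. q l \<in> A l) \<and> (\<forall>l\<ge>N. q l = (\<lambda>x. 0)) \<and> p = (\<lambda>x. \<Sum>l<N. q l x)"
  using assms(3)
proof (induction rule: complex_span_induct)
  case zero
  show ?case
    by (rule exI[of _ 0], rule exI[of _ "\<lambda>l x. 0"]) (simp add: L2_closed_subspaceD(2)[OF A])
next
  case (add f g)
  from add(1) obtain M u where
    "(\<forall>l. u l \<in> A l) \<and> (\<forall>l\<ge>M. u l = (\<lambda>x. 0)) \<and> f = (\<lambda>x. \<Sum>l<M. u l x)" by (elim exE)
  hence u: "\<And>l. u l \<in> A l" "\<And>l. l \<ge> M \<Longrightarrow> u l = (\<lambda>x. 0)" "f = (\<lambda>x. \<Sum>l<M. u l x)" by simp_all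
  from add(2) obtain N v where
    "(\<forall>l. v l \<in> A l) \<and> (\<forall>l\<ge>N. v l = (\<lambda>x. 0)) \<and> g = (\<lambda>x. \<Sum>l<N. v l x)" by (elim exE)
  hence v: "\<And>l. v l \<in> A l" "\<And>l. l \<ge> N \<Longrightarrow> v l = (\<lambda>x. 0)" "g = (\<lambda>x. \<Sum>l<N. v l x)" by simp_all
  have "(\<Sum>l<M. u l x) = (\<Sum>l<max M N. u l x)" for x
    by (rule sum.mono_neutral_left) (auto simp: u(2))
  moreover have "(\<Sum>l<N. v l x) = (\<Sum>l<max M N. v l x)" for x
    by (rule sum.mono_neutral_left) (auto simp: v(2))
  ultimately have "(\<lambda>x. f x + g x) = (\<lambda>x. \<Sum>l<max M N. u l x + v l x)"
    by (simp add: u(3) v(3) sum.distrib)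
  moreover have "(\<lambda>x. u l x + v l x) \<in> A l" for l
    by (rule L2_closed_subspaceD(3)[OF A u(1) v(1)])
  ultimately show ?case
    by (intro exI[of _ "max M N"] exI[of _ "\<lambda>l x. u l x + v l x"]) (simp add: u(2) v(2))
next
  case (scale a f)
  then obtain M u where
    "(\<forall>l. u l \<in> A l) \<and> (\<forall>l\<ge>M. u l = (\<lambda>x. 0)) \<and> f = (\<lambda>x. \<Sum>l<M. u l x)" by (elim exE)
  hence u: "\<And>l. u l \<in> A l" "\<And>l. l \<ge> M \<Longrightarrow> u l = (\<lambda>x. 0)" "f = (\<lambda>x. \<Sum>l<M. u l x)" by simp_all
  have "(\<lambda>x. a * u l x) \<in> A l" for l by (rule L2_closed_subspaceD(4)[OF A u(1)])
  thus ?case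
    by (intro exI[of _ M] exI[of _ "\<lambda>l x. a * u l x"]) (simp add: u(2,3) sum_distrib_left)
next
  case (base f)
  with assms(2) obtain k where k: "f \<in> A k" by blast
  let ?q = "\<lambda>l. if l = k then f else (\<lambda>x. 0)"
  have "(\<Sum>l<Suc k. ?q l x) = f x" for x
    by (subst sum.lessThan_Suc) simp
  thus ?case
    by (intro exI[of _ "Suc k"] exI[of _ ?q]) (auto simp: k L2_closed_subspaceD(2)[OF A])
qed

theorem proposition6p1:
  fixes \<nu> \<mu> :: real
  assumes "\<mu> > 0"
  shows "complete_orthogonal_system
           (\<lambda>(r, s). h_fun \<nu> \<mu> r s :: complex ^ 'n::{finite,linorder} \<Rightarrow> complex) \<and>
         L2_orthogonal_sum
           (A_space \<nu> \<mu> :: nat \<Rightarrow> (complex ^ 'n::{finite,linorder} \<Rightarrow> complex) set)"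
proof -
  let ?h = "h_fun \<nu> \<mu> :: (nat, 'n) vec \<Rightarrow> (nat, 'n) vec \<Rightarrow> (complex, 'n) vec \<Rightarrow> complex"
  let ?A = "A_space \<nu> \<mu> :: nat \<Rightarrow> ((complex, 'n) vec \<Rightarrow> complex) set"
  define c where "c = (of_real \<mu> + \<i> * of_real \<nu>) / 2"
  have c: "Re c > 0" "c + cnj c = of_real \<mu>"
    using assms by (simp_all add: c_def complex_eq_iff)
  have h: "?h r s = (\<lambda>z. ito_prod \<mu> (($) r) (($) s) z * gauss c z)" for r s
    unfolding c_def by (rule h_fun_eq)
  have h2: "?h r s \<in> L2_space" for r s
    unfolding h by (rule L2_subgaussian_gauss[OF subgaussian_ito_prod c(1)])
  have inner: "L2_inner (?h r s) (?h r' s') = 0 \<longleftrightarrow> (r, s) \<noteq> (r', s')" for r s r' s'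
    unfolding h L2_inner_gauss[OF c(2)] gauss_inner_orthogonal[OF assms]
    by (auto simp: vec_nth_inject)
  have range: "{?h r s | r s. True} = ito_system \<mu> c"
  proof
    show "{?h r s | r s. True} \<subseteq> ito_system \<mu> c" by (auto simp: ito_system_def h)
    have "(\<lambda>z. ito_prod \<mu> r s z * gauss c z) = ?h (\<chi> j. r j) (\<chi> j. s j)" for r s
      by (simp add: h vec_lambda_inverse)
    thus "ito_system \<mu> c \<subseteq> {?h r s | r s. True}" by (auto simp: ito_system_def)
  qed
  have complete: "L2_closed_span {?h r s | r s. True} = L2_space"
    unfolding range by (rule ito_system_complete) (use assms c in auto)
  have "complete_orthogonal_system (\<lambda>(r, s). ?h r s)"
    unfolding complete_orthogonal_system_def
  proof (intro conjI allI impI)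
    fix i j :: "(nat, 'n) vec \<times> (nat, 'n) vec"
    obtain r s r' s' where ij: "i = (r, s)" "j = (r', s')" by (metis surj_pair)
    show "(case i of (r, s) \<Rightarrow> ?h r s) \<in> L2_space" by (simp add: ij h2)
    show "L2_norm (case i of (r, s) \<Rightarrow> ?h r s) \<noteq> 0"
      using inner[of r s r s] by (auto simp: ij L2_inner_self)
    show "L2_inner (case i of (r, s) \<Rightarrow> ?h r s) (case j of (r, s) \<Rightarrow> ?h r s) = 0" if "i \<noteq> j"
      using that inner by (simp add: ij)
  next
    have "range (\<lambda>(r, s). ?h r s) = {?h r s | r s. True}" by (auto simp: image_def)
    thus "L2_closed_span (range (\<lambda>(r, s). ?h r s)) = L2_space" using complete by simp
  qed
  moreover have "L2_orthogonal_sum ?A"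
  proof (rule L2_orthogonal_sumI)
    let ?S = "\<lambda>l. {?h r s | r s. msize r = l}"
    have S2: "?S l \<subseteq> L2_space" for l using h2 by auto
    have A_def: "?A l = L2_closed_span (?S l)" for l by (simp add: A_space_def)
    show A: "L2_closed_subspace (?A l)" for l
      unfolding A_def by (rule L2_closed_subspace_closed_span[OF S2])
    show "L2_inner f g = 0" if "k \<noteq> l" "f \<in> ?A k" "g \<in> ?A l" for k l f g
      using that(2,3) unfolding A_def
      by (rule L2_closed_spans_orthogonal[OF S2 S2, rotated]) (use inner that(1) in auto)
    fix f :: "(complex, 'n) vec \<Rightarrow> complex" and e :: real
    assume "f \<in> L2_space" "e > 0"
    with complete obtain p where p: "p \<in> complex_span {?h r s | r s. True}" "L2_norm (\<lambda>x. f x - p x) < e"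
      unfolding L2_closed_span_def L2_closure_def by blast
    have "{?h r s | r s. True} \<subseteq> (\<Union>l. ?A l)"
      using L2_closed_span_base[OF S2] unfolding A_def by blast
    from complex_span_decomposition[OF A this p(1)]
    have "\<exists>N q. (\<forall>l. q l \<in> ?A l) \<and> p = (\<lambda>x. \<Sum>l<N. q l x)" by blast
    then obtain N q where "\<And>l. q l \<in> ?A l" "p = (\<lambda>x. \<Sum>l<N. q l x)" by blast
    with p(2) show "\<exists>N q. (\<forall>l. q l \<in> ?A l) \<and> L2_norm (\<lambda>x. f x - (\<Sum>l<N. q l x)) < e"
      by (intro exI[of _ N] exI[of _ q]) auto
  qed
  ultimately show ?thesis by blast
qed

end
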